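(* Let $d\ge1$ and let $\{M_n\}_{n\in\mathbb N^d}$ be a stationary orthomartingale with respect to a commuting filtration $\{\mathcal F_n\}_{n\in\mathbb Z_+^d}$, with orthomartingale differences $\{D_n\}_{n\in\mathbb N^d}$. Suppose $\mathbb E D_{\mathbf 1}^2<\infty$. Then $$\lim_{a\to\infty}\limsup_{n\to\infty}\mathbb E\left(Y_n^2\,\mathbf 1_{\{Y_n^2>a\}}\right)=0,\qquad\text{where } Y_n=\max_{\mathbf 1\le i\le n}\frac{|M_i|}{|n|^{1/2}} .$$
   Context: Let $(\Omega,\mathcal F,\mathbb P)$ be a probability space, $\mathbb N=\{1,2,\dots\}$, $\mathbb Z_+=\{0\}\cup\mathbb N$. Order relations and $\wedge$ on $\mathbb Z^d$ are coordinatewise; $\mathbf 1=(1,\dots,1)$; $|n|=\prod_{q=1}^dn_q$; $n\to\infty$ means $n_q\to\infty$ for every $q=1,\dots,d$. A family of sub-$\sigma$-algebras $\{\mathcal F_i\}_{i\in\mathbb Z_+^d}$ of $\mathcal F$ is a filtration if $\mathcal F_i\subset\mathcal F_j$ whenever $i\le j$; it is commuting if in addition, for all $k,\ell\in\mathbb Z_+^d$ and every bounded $\mathcal F_\ell$-measurable random variable $Y$, $\mathbb E(Y\mid\mathcal F_k)=\mathbb E(Y\mid\mathcal F_{k\wedge\ell})$ almost surely. $\{M_n\}_{n\in\mathbb N^d}$ is an orthomartingale with respect to a commuting filtration $\{\mathcal F_i\}_{i\in\mathbb Z_+^d}$ if each $M_n$ is $\mathcal F_n$-measurable with $\mathbb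 E|M_n|<\infty$ and, with the convention $M_n\equiv0$ if $\min\{n_1,\dots,n_d\}=0$, $\mathbb E(M_j\mid\mathcal F_i)=M_i$ for all $i,j\in\mathbb Z_+^d$, $i\le j$. Its orthomartingale differences are the (unique) random variables $\{D_n\}_{n\in\mathbb N^d}$ with $M_n=\sum_{\mathbf 1\le i\le n}D_i$ for all $n\in\mathbb N^d$. The orthomartingale is called stationary if $\{D_n\}_{n\in\mathbb N^d}$ is strictly stationary. *)

theory Defs
  imports "HOL-Probability.Probability" "HOL-Library.Function_Algebras"
begin

text \<open>
  Multi-indices in \<open>\<int>\<^sub>+\<^sup>d\<close> are functions \<open>'d \<Rightarrow> nat\<close> on a finite index type with \<open>CARD('d) = d\<close>.
  The order, \<open>inf\<close>, \<open>+\<close> and \<open>1\<close> on them are the coordinatewise library ones, so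
  \<open>1 \<le> n\<close> says \<open>n \<in> \<nat>\<^sup>d\<close>. Families indexed by \<open>\<nat>\<^sup>d\<close> are total functions whose values at
  indices with a zero coordinate are never used.
\<close>

definition multi_at_top :: "('d::finite \<Rightarrow> nat) filter" where
  "multi_at_top = (INF q. filtercomap (\<lambda>n. n q) at_top)"

definition multi_filtration :: "'a measure \<Rightarrow> (('d::finite \<Rightarrow> nat) \<Rightarrow> 'a measure) \<Rightarrow> bool" where
  "multi_filtration P F \<longleftrightarrow>
     (\<forall>i. subalgebra P (F i)) \<and> (\<forall>i j. i \<le> j \<longrightarrow> sets (F i) \<subseteq> sets (F j))"

definition commuting_filtration :: "'a measure \<Rightarrow> (('d::finite \<Rightarrow> nat) \<Rightarrow> 'a measure) \<Rightarrow> bool" where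
  "commuting_filtration P F \<longleftrightarrow>
     multi_filtration P F \<and>
     (\<forall>k l. \<forall>Y \<in> borel_measurable (F l). (\<exists>C. \<forall>x\<in>space P. \<bar>Y x\<bar> \<le> C) \<longrightarrow>
        (AE x in P. real_cond_exp P (F k) Y x = real_cond_exp P (F (inf k l)) Y x))"

definition zero_ext :: "(('d::finite \<Rightarrow> nat) \<Rightarrow> 'a \<Rightarrow> real) \<Rightarrow> ('d \<Rightarrow> nat) \<Rightarrow> 'a \<Rightarrow> real" where
  "zero_ext M n = (if \<exists>q. n q = 0 then (\<lambda>_. 0) else M n)"

definition orthomartingale ::
    "'a measure \<Rightarrow> (('d::finite \<Rightarrow> nat) \<Rightarrow> 'a measure) \<Rightarrow> (('d \<Rightarrow> nat) \<Rightarrow> 'a \<Rightarrow> real) \<Rightarrow> bool" where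
  "orthomartingale P F M \<longleftrightarrow>
     (\<forall>n. 1 \<le> n \<longrightarrow> M n \<in> borel_measurable (F n) \<and> integrable P (M n)) \<and>
     (\<forall>i j. i \<le> j \<longrightarrow> (AE x in P. real_cond_exp P (F i) (zero_ext M j) x = zero_ext M i x))"

definition orthomartingale_differences ::
    "'a measure \<Rightarrow> (('d::finite \<Rightarrow> nat) \<Rightarrow> 'a \<Rightarrow> real) \<Rightarrow> (('d \<Rightarrow> nat) \<Rightarrow> 'a \<Rightarrow> real) \<Rightarrow> bool" where
  "orthomartingale_differences P M D \<longleftrightarrow>
     (\<forall>n. 1 \<le> n \<longrightarrow> D n \<in> borel_measurable P \<and> (\<forall>x\<in>space P. M n x = (\<Sum>i\<in>{1..n}. D i x)))"

definition strictly_stationary ::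
    "'a measure \<Rightarrow> (('d::finite \<Rightarrow> nat) \<Rightarrow> 'a \<Rightarrow> real) \<Rightarrow> bool" where
  "strictly_stationary P D \<longleftrightarrow>
     (\<forall>n. 1 \<le> n \<longrightarrow> D n \<in> borel_measurable P) \<and>
     (\<forall>k J. finite J \<longrightarrow> J \<subseteq> {1..} \<longrightarrow>
        distr P (Pi\<^sub>M J (\<lambda>_. borel)) (\<lambda>x. \<lambda>i\<in>J. D (i + k) x) =
        distr P (Pi\<^sub>M J (\<lambda>_. borel)) (\<lambda>x. \<lambda>i\<in>J. D i x))"

definition normalized_max ::
    "(('d::finite \<Rightarrow> nat) \<Rightarrow> 'a \<Rightarrow> real) \<Rightarrow> ('d \<Rightarrow> nat) \<Rightarrow> 'a \<Rightarrow> real" where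
  "normalized_max M n x = (MAX i\<in>{1..n}. \<bar>M i x\<bar> / sqrt (real (\<Prod>q\<in>UNIV. n q)))"

lemma filterlim_multi_at_top:
  "filterlim f multi_at_top G \<longleftrightarrow> (\<forall>q. filterlim (\<lambda>x. f x q) at_top G)"
  by (simp add: multi_at_top_def filterlim_INF filterlim_filtercomap_iff o_def)

lemma finite_multi_box: "finite {m..n :: 'd::finite \<Rightarrow> nat}"
proof (rule finite_subset)
  show "{m..n} \<subseteq> (\<Pi>\<^sub>E q\<in>UNIV. {..n q})"
    by (auto simp: le_fun_def PiE_UNIV_domain)
  show "finite (\<Pi>\<^sub>E q\<in>(UNIV::'d set). {..n q})"
    by (intro finite_PiE) auto
qed

end

theory Submission imports Defs begin

text \<open>
  Split \<open>D\<^sub>i\<close> at a level \<open>A\<close> into a bounded and a tail part and project both onto the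
  orthomartingale differences. The bounded part gives an orthomartingale whose fourth moment at
  \<open>n\<close> is at most \<open>C A\<^sup>4 |n|\<^sup>2\<close>, and the tail part one whose second moment is at most
  \<open>C |n| E[D\<^sub>1\<^sup>2; |D\<^sub>1| > A]\<close>. Doob's maximal inequality, iterated over the coordinates (Cairoli),
  carries both bounds over to the maxima, so that
  \<open>E[Y\<^sub>n\<^sup>2; Y\<^sub>n\<^sup>2 > a] \<le> C (E[D\<^sub>1\<^sup>2; |D\<^sub>1| > A] + A\<^sup>4 / a)\<close> uniformly in \<open>n\<close>. The choice
  \<open>A = a\<close> to the power \<open>1/8\<close> then lets the right-hand side tend to \<open>0\<close>.
\<close>

section \<open>Elementary inequalities\<close>

text \<open>A truncated \<open>D i\<close> need not have vanishing conditional expectations any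
  more, hence the projection \<open>diff_proj\<close>; it fixes \<open>D i\<close>, so the split
  stays exact. Stationarity need not survive it, because nothing ties the filtration to the shift.
  Every estimate on the projected fields therefore comes from the law of the single
  \<open>D i\<close>: a uniform bound for one part, a second moment for the other. A moment above
  the second is what turns the constraint \<open>Y^2 > a\<close> into a factor \<open>1 / a\<close>.
  A single L2 inequality serves both maxima: it is applied to the square of the bounded part and to
  the absolute value of the tail part.\<close>

lemma alternating_sum_eq_0:
  fixes f :: "'d set \<Rightarrow> real"
  assumes "finite A" "q \<in> A" "\<And>S. S \<subseteq> A - {q} \<Longrightarrow> f (insert q S) = f S"
  shows "(\<Sum>S\<in>Pow A. (-1) ^ card S * f S) = 0"
proof -
  let ?B = "A - {q}"
  have inj: "inj_on (insert q) (Pow ?B)"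
    by (auto simp: inj_on_def)
  have "Pow A = Pow ?B \<union> insert q ` Pow ?B"
    using Pow_insert[of q ?B] assms(2) by (simp add: insert_absorb)
  moreover have "Pow ?B \<inter> insert q ` Pow ?B = {}"
    by auto
  ultimately have "(\<Sum>S\<in>Pow A. (-1) ^ card S * f S) =
      (\<Sum>S\<in>Pow ?B. (-1) ^ card S * f S) + (\<Sum>S\<in>insert q ` Pow ?B. (-1) ^ card S * f S)"
    using assms(1) by (simp add: sum.union_disjoint)
  \<comment> \<open>Inserting \<open>q\<close> flips the sign and leaves \<open>f\<close> unchanged,
    so the two halves of \<open>Pow A\<close> cancel.\<close>
  also have "(\<Sum>S\<in>insert q ` Pow ?B. (-1) ^ card S * f S) = (\<Sum>S\<in>Pow ?B. - ((-1) ^ card S * f S))"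
  proof (subst sum.reindex[OF inj], rule sum.cong[OF refl])
    fix S assume "S \<in> Pow ?B"
    moreover from this have "finite S" "q \<notin> S"
      using assms(1) by (auto intro: finite_subset)
    ultimately show "((\<lambda>S. (-1) ^ card S * f S) \<circ> insert q) S = - ((-1) ^ card S * f S)"
      using assms(3)[of S] by simp
  qed
  finally show ?thesis
    by (simp add: sum_negf)
qed

section \<open>Square integrability of products, sums and maxima\<close>

lemma integrable_mult_square:
  fixes f g :: "'a \<Rightarrow> real"
  assumes [measurable]: "f \<in> borel_measurable M" "g \<in> borel_measurable M"
    and "integrable M (\<lambda>x. (f x)\<^sup>2)" "integrable M (\<lambda>x. (g x)\<^sup>2)"
  shows "integrable M (\<lambda>x. f x * g x)"
proof (rule Bochner_Integration.integrable_bound)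
  show "integrable M (\<lambda>x. (f x)\<^sup>2 + (g x)\<^sup>2)"
    using assms by simp
  have "\<bar>a * b\<bar> \<le> a\<^sup>2 + b\<^sup>2" for a b :: real
  proof -
    have "0 \<le> \<bar>a\<bar> * \<bar>b\<bar>" "2 * (\<bar>a\<bar> * \<bar>b\<bar>) \<le> a\<^sup>2 + b\<^sup>2"
      using sum_squares_bound[of "\<bar>a\<bar>" "\<bar>b\<bar>"] by simp_all
    then show ?thesis
      unfolding abs_mult by linarith
  qed
  then show "AE x in M. norm (f x * g x) \<le> norm ((f x)\<^sup>2 + (g x)\<^sup>2)"
    by simp
qed simp

lemma (in finite_measure) integrable_of_square:
  fixes f :: "'a \<Rightarrow> real"
  assumes "f \<in> borel_measurable M" "integrable M (\<lambda>x. (f x)\<^sup>2)"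
  shows "integrable M f"
  using integrable_mult_square[of f M "\<lambda>_. 1"] assms by simp

lemma integrable_sum_square:
  fixes f :: "'i \<Rightarrow> 'a \<Rightarrow> real"
  assumes "\<And>i. i \<in> I \<Longrightarrow> f i \<in> borel_measurable M"
    and "\<And>i. i \<in> I \<Longrightarrow> integrable M (\<lambda>x. (f i x)\<^sup>2)"
  shows "integrable M (\<lambda>x. (\<Sum>i\<in>I. f i x)\<^sup>2)"
proof -
  have "(\<lambda>x. (\<Sum>i\<in>I. f i x)\<^sup>2) = (\<lambda>x. \<Sum>i\<in>I. \<Sum>j\<in>I. f i x * f j x)"
    by (simp add: power2_eq_square sum_product)
  then show ?thesis
    using assms by (simp add: integrable_mult_square)
qed

lemma integrable_Max_square:
  fixes f :: "'i \<Rightarrow> 'a \<Rightarrow> real"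
  assumes I: "finite I" "I \<noteq> {}"
    and [measurable]: "\<And>i. i \<in> I \<Longrightarrow> f i \<in> borel_measurable M"
    and int: "\<And>i. i \<in> I \<Longrightarrow> integrable M (\<lambda>x. (f i x)\<^sup>2)"
  shows "integrable M (\<lambda>x. (MAX i\<in>I. f i x)\<^sup>2)"
proof (rule Bochner_Integration.integrable_bound)
  show "integrable M (\<lambda>x. \<Sum>i\<in>I. (f i x)\<^sup>2)"
    using int by simp
  show "(\<lambda>x. (MAX i\<in>I. f i x)\<^sup>2) \<in> borel_measurable M"
    using I by measurable
  have "(MAX i\<in>I. f i x)\<^sup>2 \<le> (\<Sum>i\<in>I. (f i x)\<^sup>2)" for x
  proof -
    have "(MAX i\<in>I. f i x) \<in> (\<lambda>i. f i x) ` I"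
      using I by (intro Max_in) auto
    then obtain i where "i \<in> I" "(MAX i\<in>I. f i x) = f i x"
      by auto
    then show ?thesis
      using I member_le_sum[of i I "\<lambda>i. (f i x)\<^sup>2"] by simp
  qed
  then show "AE x in M. norm ((MAX i\<in>I. f i x)\<^sup>2) \<le> norm (\<Sum>i\<in>I. (f i x)\<^sup>2)"
    by (simp add: sum_nonneg)
qed

text \<open>Doob's L2 inequality before expectations are taken: the sum is the discrete stochastic
  integral of the running maximum against \<open>v\<close>, whose mean is nonnegative for a
  nonnegative submartingale. A step without a new record preserves the slack; a record adds the
  square of its excess over the old maximum.\<close>

lemma running_max_square_bound:
  fixes v :: "nat \<Rightarrow> real"
  assumes "N \<ge> 1"
  shows "(MAX k\<in>{1..N}. v k)\<^sup>2 + 2 * (\<Sum>m\<in>{1..<N}. (MAX k\<in>{1..m}. v k) * (v (Suc m) - v m))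
    \<le> 2 * (MAX k\<in>{1..N}. v k) * v N"
  using assms
proof (induction N rule: nat_induct_at_least)
  case base
  then show ?case by (simp add: power2_eq_square)
next
  case (Suc N)
  define R where "R m = (MAX k\<in>{1..m}. v k)" for m
  have R: "R (Suc N) = max (v (Suc N)) (R N)"
    using Suc.hyps by (simp add: R_def atLeastAtMostSuc_conv)
  have "(R N)\<^sup>2 + 2 * (\<Sum>m\<in>{1..<N}. R m * (v (Suc m) - v m)) \<le> 2 * R N * v N"
    using Suc.IH by (simp add: R_def)
  moreover have "(\<Sum>m\<in>{1..<Suc N}. R m * (v (Suc m) - v m)) =
      (\<Sum>m\<in>{1..<N}. R m * (v (Suc m) - v m)) + R N * (v (Suc N) - v N)"
    using Suc.hyps by simp
  moreover have "0 \<le> (v (Suc N) - R N)\<^sup>2"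
    by simp
  ultimately have "(R (Suc N))\<^sup>2 + 2 * (\<Sum>m\<in>{1..<Suc N}. R m * (v (Suc m) - v m)) \<le> 2 * R (Suc N) * v (Suc N)"
    unfolding R by (cases "v (Suc N) \<le> R N") (simp_all add: max_def power2_eq_square algebra_simps)
  then show ?case
    by (simp add: R_def)
qed

text \<open>The bounds are written as squares so that the step can be iterated: adding
  \<open>Y\<close> raises the root from \<open>a\<close> to \<open>a + 4 * b\<close>, hence roots
  grow linearly in the number of summands.\<close>

lemma fourth_moment_add:
  fixes X Y :: "'a \<Rightarrow> real"
  assumes pos: "a > 0" "b > 0"
    and int: "integrable M (\<lambda>x. X x ^ 4)" "integrable M (\<lambda>x. Y x ^ 4)" "integrable M (\<lambda>x. X x ^ 3 * Y x)"
      "integrable M (\<lambda>x. (X x + Y x) ^ 4)"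
    and X: "(\<integral>x. X x ^ 4 \<partial>M) \<le> a\<^sup>2" and Y: "(\<integral>x. Y x ^ 4 \<partial>M) \<le> b\<^sup>2"
    and XY: "(\<integral>x. X x ^ 3 * Y x \<partial>M) = 0"
  shows "(\<integral>x. (X x + Y x) ^ 4 \<partial>M) \<le> (a + 4 * b)\<^sup>2"
proof -
  have bound: "(x + y) ^ 4 \<le> (1 + 4 * b / a) * x ^ 4 + 4 * (x ^ 3 * y) + (3 + 4 * a / b) * y ^ 4" for x y :: real
  proof -
    \<comment> \<open>Absorbs the cross term \<open>4 * x * y^3\<close> into
      \<open>2 * x^2 * y^2 + 2 * y^4\<close>.\<close>
    have "0 \<le> 2 * y\<^sup>2 * (x - y)\<^sup>2"
      by simp
    then have "(x + y) ^ 4 \<le> x ^ 4 + 4 * (x ^ 3 * y) + 8 * (x\<^sup>2 * y\<^sup>2) + 3 * y ^ 4"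
      by (simp add: power2_eq_square power3_eq_cube power4_eq_xxxx algebra_simps)
    \<comment> \<open>The weights \<open>b / a\<close> and \<open>a / b\<close> let each moment
      contribute \<open>4 * a * b\<close>; the total \<open>8 * a * b\<close> is the mixed term of
      \<open>(a + 4 * b)^2\<close>.\<close>
    moreover have "0 \<le> (b * x\<^sup>2 - a * y\<^sup>2)\<^sup>2 / (a * b)"
      using pos by simp
    then have "2 * (x\<^sup>2 * y\<^sup>2) \<le> b / a * x ^ 4 + a / b * y ^ 4"
      using pos by (simp add: power2_eq_square power4_eq_xxxx field_simps)
    moreover have "(1 + 4 * b / a) * x ^ 4 = x ^ 4 + 4 * (b / a * x ^ 4)"
      "(3 + 4 * a / b) * y ^ 4 = 3 * y ^ 4 + 4 * (a / b * y ^ 4)"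
      by (simp_all add: distrib_right)
    ultimately show ?thesis
      by linarith
  qed
  have "(\<integral>x. (X x + Y x) ^ 4 \<partial>M) \<le>
      (\<integral>x. (1 + 4 * b / a) * X x ^ 4 + 4 * (X x ^ 3 * Y x) + (3 + 4 * a / b) * Y x ^ 4 \<partial>M)"
    using int by (intro integral_mono bound) auto
  also have "\<dots> = (1 + 4 * b / a) * (\<integral>x. X x ^ 4 \<partial>M) + (3 + 4 * a / b) * (\<integral>x. Y x ^ 4 \<partial>M)"
    using int XY by simp
  also have "\<dots> \<le> (1 + 4 * b / a) * a\<^sup>2 + (3 + 4 * a / b) * b\<^sup>2"
    using X Y pos by (intro add_mono mult_left_mono) auto
  also have "\<dots> = a\<^sup>2 + 8 * a * b + 3 * b\<^sup>2"
    using pos by (simp add: power2_eq_square field_simps)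
  also have "\<dots> \<le> (a + 4 * b)\<^sup>2"
    by (simp add: power2_eq_square algebra_simps)
  finally show ?thesis .
qed

section \<open>Commuting filtrations and orthomartingale differences\<close>

locale commuting_prob_space = prob_space P
  for P :: "'a measure" +
  fixes F :: "('d::finite \<Rightarrow> nat) \<Rightarrow> 'a measure"
  assumes comm: "commuting_filtration P F"
begin

lemma subalgebra_F: "subalgebra P (F i)"
  using comm by (simp add: commuting_filtration_def multi_filtration_def)

lemma sets_F_mono: "i \<le> j \<Longrightarrow> sets (F i) \<subseteq> sets (F j)"
  using comm by (simp add: commuting_filtration_def multi_filtration_def)

lemma subalgebra_F_mono: "i \<le> j \<Longrightarrow> subalgebra (F j) (F i)"
  using subalgebra_F[of i] subalgebra_F[of j] sets_F_mono by (simp add: subalgebra_def)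

sublocale sigma_finite_subalgebra P "F i" for i
  by (rule finite_measure_subalgebra_is_sigma_finite)
    (simp add: finite_measure_subalgebra_def finite_measure_subalgebra_axioms_def finite_measure_axioms subalgebra_F)

lemma measurable_F_mono:
  "f \<in> borel_measurable (F i) \<Longrightarrow> i \<le> j \<Longrightarrow> f \<in> borel_measurable (F j)"
  by (rule measurable_from_subalg[OF subalgebra_F_mono])

lemma measurable_F_P: "f \<in> borel_measurable (F i) \<Longrightarrow> f \<in> borel_measurable P"
  by (rule measurable_from_subalg[OF subalgebra_F])

lemma cond_exp_sum:
  fixes f :: "'i \<Rightarrow> 'a \<Rightarrow> real"
  assumes "\<And>i. i \<in> I \<Longrightarrow> integrable P (f i)"
  shows "AE x in P. real_cond_exp P (F k) (\<lambda>x. \<Sum>i\<in>I. f i x) x = (\<Sum>i\<in>I. real_cond_exp P (F k) (f i) x)"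
proof -
  \<comment> \<open>Padding with 0 outside \<open>I\<close> makes every member of the family
    integrable, as \<open>real_cond_exp_sum\<close> requires.\<close>
  define g where "g i = (if i \<in> I then f i else (\<lambda>_. 0))" for i
  have "integrable P (g i)" for i
    using assms by (simp add: g_def)
  then have "AE x in P. real_cond_exp P (F k) (\<lambda>x. \<Sum>i\<in>I. g i x) x = (\<Sum>i\<in>I. real_cond_exp P (F k) (g i) x)"
    by (rule real_cond_exp_sum)
  then show ?thesis
    by (simp add: g_def)
qed

text \<open>Commutation is assumed for bounded variables only; it transfers to integrable \<open>X\<close> because
  testing against an event of \<open>F k\<close> moves the conditional expectations onto its indicator.\<close>

lemma cond_exp_commute:
  fixes X :: "'a \<Rightarrow> real"
  assumes X [measurable]: "integrable P X"
  shows "AE x in P. real_cond_exp P (F k) (real_cond_exp P (F l) X) x = real_cond_exp P (F (inf k l)) X x"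
proof (rule real_cond_exp_charact)
  fix A assume A: "A \<in> sets (F k)"
  have AP [measurable]: "A \<in> sets P"
    using A subalgebra_F by (auto simp: subalgebra_def)
  have [measurable]: "X \<in> borel_measurable P"
    using X by simp
  define h where "h = (indicator A :: 'a \<Rightarrow> real)"
  have h [measurable]: "h \<in> borel_measurable (F k)" "h \<in> borel_measurable P"
    using A by (simp_all add: h_def)
  have hint: "integrable P h"
    using AP by (simp add: h_def less_top[symmetric])
  have comm_h: "AE x in P. real_cond_exp P (F l) h x = real_cond_exp P (F (inf k l)) h x"
  proof -
    have "\<exists>C. \<forall>x\<in>space P. \<bar>h x\<bar> \<le> C"
      by (rule exI[of _ 1]) (simp add: h_def indicator_def)
    then have "AE x in P. real_cond_exp P (F l) h x = real_cond_exp P (F (inf l k)) h x"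
      using comm h(1) unfolding commuting_filtration_def by blast
    then show ?thesis
      by (simp only: inf_commute)
  qed
  have b: "AE x in P. \<bar>real_cond_exp P (F j) h x\<bar> \<le> 1" for j
  proof -
    have "AE x in P. 0 \<le> real_cond_exp P (F j) h x" "AE x in P. real_cond_exp P (F j) h x \<le> 1"
      by (rule real_cond_exp_ge_c real_cond_exp_le_c; use hint in \<open>simp add: h_def\<close>)+
    then show ?thesis by eventually_elim simp
  qed
  have bX: "integrable P (\<lambda>x. g x * Y x)" if "integrable P Y" "AE x in P. \<bar>g x\<bar> \<le> 1" "g \<in> borel_measurable P"
    for g Y :: "'a \<Rightarrow> real"
  proof (rule Bochner_Integration.integrable_bound[OF that(1)])
    show "AE x in P. norm (g x * Y x) \<le> norm (Y x)"
      using that(2) by eventually_elim (simp add: abs_mult mult_left_le_one_le)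
    show "(\<lambda>x. g x * Y x) \<in> borel_measurable P"
      using that by measurable
  qed
  have h1: "AE x in P. \<bar>h x\<bar> \<le> 1"
    by (simp add: h_def indicator_def)
  \<comment> \<open>Conditional expectation is self-adjoint for the pairing of bounded with
    integrable variables: both sides equal the pairing of the two conditional expectations.\<close>
  have dual: "(\<integral>x. h x * real_cond_exp P (F j) X x \<partial>P) = (\<integral>x. real_cond_exp P (F j) h x * X x \<partial>P)" for j
  proof -
    have "(\<integral>x. h x * real_cond_exp P (F j) X x \<partial>P) = (\<integral>x. real_cond_exp P (F j) X x * h x \<partial>P)"
      by (simp add: mult.commute)
    also have "\<dots> = (\<integral>x. real_cond_exp P (F j) X x * real_cond_exp P (F j) h x \<partial>P)"
      using bX[OF real_cond_exp_int(1)[OF X] h1, of j]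
      by (intro real_cond_exp_intg(2)[symmetric]) (simp_all add: mult.commute)
    also have "\<dots> = (\<integral>x. real_cond_exp P (F j) h x * real_cond_exp P (F j) X x \<partial>P)"
      by (simp add: mult.commute)
    also have "\<dots> = (\<integral>x. real_cond_exp P (F j) h x * X x \<partial>P)"
      by (intro real_cond_exp_intg(2) bX[OF X b]) simp_all
    finally show ?thesis .
  qed
  have "(\<integral>x. h x * real_cond_exp P (F l) X x \<partial>P) = (\<integral>x. real_cond_exp P (F l) h x * X x \<partial>P)"
    by (rule dual)
  also have "\<dots> = (\<integral>x. real_cond_exp P (F (inf k l)) h x * X x \<partial>P)"
    using comm_h by (intro integral_cong_AE) (auto elim!: eventually_mono)
  also have "\<dots> = (\<integral>x. h x * real_cond_exp P (F (inf k l)) X x \<partial>P)"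
    by (rule dual[symmetric])
  finally show "(\<integral>x\<in>A. real_cond_exp P (F l) X x \<partial>P) = (\<integral>x\<in>A. real_cond_exp P (F (inf k l)) X x \<partial>P)"
    by (simp add: set_lebesgue_integral_def h_def)
next
  show "real_cond_exp P (F (inf k l)) X \<in> borel_measurable (F k)"
    by (rule measurable_F_mono[of _ "inf k l"]) simp_all
qed (rule real_cond_exp_int(1)[OF X])+

text \<open>Here \<open>k\<close> ranges over all indices not above \<open>i\<close>, incomparable
  ones included. A difference can thus be tested against any sigma-algebra whose index is below
  \<open>i\<close> in at least one coordinate.\<close>

definition ortho_diffs :: "(('d \<Rightarrow> nat) \<Rightarrow> 'a \<Rightarrow> real) \<Rightarrow> bool" where
  "ortho_diffs G \<longleftrightarrow> (\<forall>i\<ge>1. G i \<in> borel_measurable (F i) \<and> integrable P (G i) \<and>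
     (\<forall>k. \<not> i \<le> k \<longrightarrow> (AE x in P. real_cond_exp P (F k) (G i) x = 0)))"

lemma ortho_diffsD:
  assumes "ortho_diffs G" "1 \<le> i"
  shows "G i \<in> borel_measurable (F i)" "integrable P (G i)" "G i \<in> borel_measurable P"
    "\<And>k. \<not> i \<le> k \<Longrightarrow> AE x in P. real_cond_exp P (F k) (G i) x = 0"
  using assms by (simp_all add: ortho_diffs_def measurable_F_P borel_measurable_integrable)

lemma ortho_diffs_integral_mult:
  assumes G: "ortho_diffs G" "1 \<le> i" and h: "h \<in> borel_measurable (F k)"
    and int: "integrable P (\<lambda>x. h x * G i x)" and "\<not> i \<le> k"
  shows "(\<integral>x. h x * G i x \<partial>P) = 0"
proof -
  note [measurable] = ortho_diffsD(3)[OF G] measurable_F_P[OF h]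
  have "(\<integral>x. h x * G i x \<partial>P) = (\<integral>x. h x * real_cond_exp P (F k) (G i) x \<partial>P)"
    by (rule real_cond_exp_intg(2)[OF int h, symmetric]) simp
  also have "\<dots> = (\<integral>x. 0 \<partial>P)"
    using ortho_diffsD(4)[OF G \<open>\<not> i \<le> k\<close>] by (intro integral_cong_AE) (auto elim!: eventually_mono)
  finally show ?thesis by simp
qed

lemma ortho_diffs_sum_measurable:
  assumes G: "ortho_diffs G" and I: "I \<subseteq> {1..n}"
  shows "(\<lambda>x. \<Sum>i\<in>I. G i x) \<in> borel_measurable (F n)"
proof (rule borel_measurable_sum)
  fix i assume "i \<in> I"
  then have "1 \<le> i" "i \<le> n" using I by auto
  then show "G i \<in> borel_measurable (F n)"
    using ortho_diffsD(1)[OF G] measurable_F_mono by blast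
qed

lemma ortho_diffs_sum_cond_exp:
  assumes G: "ortho_diffs G"
  shows "AE x in P. real_cond_exp P (F k) (\<lambda>x. \<Sum>i\<in>{1..n}. G i x) x = (\<Sum>i\<in>{1..inf n k}. G i x)"
proof -
  have "AE x in P. real_cond_exp P (F k) (G i) x = (if i \<le> k then G i x else 0)" if "i \<in> {1..n}" for i
  proof (cases "i \<le> k")
    case True
    with that ortho_diffsD(1,2)[OF G, of i] have "AE x in P. real_cond_exp P (F k) (G i) x = G i x"
      by (intro real_cond_exp_F_meas) (auto intro: measurable_F_mono)
    with True show ?thesis by simp
  qed (use that ortho_diffsD(4)[OF G, of i k] in simp)
  then have "AE x in P. \<forall>i\<in>{1..n}. real_cond_exp P (F k) (G i) x = (if i \<le> k then G i x else 0)"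
    by (intro AE_finite_allI finite_multi_box)
  moreover have "AE x in P. real_cond_exp P (F k) (\<lambda>x. \<Sum>i\<in>{1..n}. G i x) x = (\<Sum>i\<in>{1..n}. real_cond_exp P (F k) (G i) x)"
    by (rule cond_exp_sum) (use ortho_diffsD(2)[OF G] in auto)
  ultimately show ?thesis
  proof eventually_elim
    case (elim x)
    \<comment> \<open>Both sides are empty if \<open>k\<close> has a zero coordinate, in accordance
      with the convention that the orthomartingale vanishes there.\<close>
    have "{1..inf n k} = {1..n} \<inter> {i. i \<le> k}"
      by auto
    then show ?case
      using elim by (simp add: sum.If_cases finite_multi_box)
  qed
qed

text \<open>Distinct indices fail at least one of the two comparisons. Conditioning on the
  sigma-algebra of the index that is not above the other then kills the product.\<close>

lemma ortho_diffs_second_moment: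
  assumes G: "ortho_diffs G" and sq: "\<And>i. i \<in> {1..n} \<Longrightarrow> integrable P (\<lambda>x. (G i x)\<^sup>2)"
  shows "(\<integral>x. (\<Sum>i\<in>{1..n}. G i x)\<^sup>2 \<partial>P) = (\<Sum>i\<in>{1..n}. \<integral>x. (G i x)\<^sup>2 \<partial>P)"
proof -
  have int: "integrable P (\<lambda>x. G i x * G j x)" if "i \<in> {1..n}" "j \<in> {1..n}" for i j
    using that ortho_diffsD(3)[OF G] sq by (intro integrable_mult_square) auto
  have orth: "(\<integral>x. G i x * G j x \<partial>P) = 0" if ij: "i \<in> {1..n}" "j \<in> {1..n}" "\<not> j \<le> i" for i j
    using ij by (intro ortho_diffs_integral_mult[OF G, where k = i] int ortho_diffsD(1)[OF G]) auto
  have orth': "(\<integral>x. G i x * G j x \<partial>P) = (if j = i then \<integral>x. (G i x)\<^sup>2 \<partial>P else 0)" if ij: "i \<in> {1..n}" "j \<in> {1..n}" for i j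
  proof (cases "j \<le> i \<and> i \<le> j")
    case False
    then show ?thesis
      using orth[OF ij] orth[OF ij(2,1)] by (cases "j \<le> i") (auto simp: mult.commute)
  next
    case True
    then have "j = i" by (blast intro: order.antisym)
    then show ?thesis by (simp add: power2_eq_square)
  qed
  have "(\<integral>x. (\<Sum>i\<in>{1..n}. G i x)\<^sup>2 \<partial>P) = (\<integral>x. (\<Sum>i\<in>{1..n}. \<Sum>j\<in>{1..n}. G i x * G j x) \<partial>P)"
    by (simp add: power2_eq_square sum_product)
  also have "\<dots> = (\<Sum>i\<in>{1..n}. \<Sum>j\<in>{1..n}. \<integral>x. G i x * G j x \<partial>P)"
    by (subst Bochner_Integration.integral_sum)
      (auto intro!: Bochner_Integration.integrable_sum Bochner_Integration.integral_sum sum.cong int)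
  also have "\<dots> = (\<Sum>i\<in>{1..n}. \<Sum>j\<in>{1..n}. if j = i then \<integral>x. (G i x)\<^sup>2 \<partial>P else 0)"
    using orth' by (intro sum.cong refl) auto
  also have "\<dots> = (\<Sum>i\<in>{1..n}. \<integral>x. (G i x)\<^sup>2 \<partial>P)"
    by (simp add: finite_multi_box)
  finally show ?thesis .
qed

end

section \<open>Fourth moments\<close>

text \<open>Conditional expectations inherit bounds almost everywhere only. The class is closed
  under sums and products, which makes every monomial in the fourth-moment expansion
  integrable.\<close>

definition ae_bounded :: "'a measure \<Rightarrow> ('a \<Rightarrow> real) \<Rightarrow> bool" where
  "ae_bounded M f \<longleftrightarrow> f \<in> borel_measurable M \<and> (\<exists>C. AE x in M. \<bar>f x\<bar> \<le> C)"

lemma ae_boundedI: "f \<in> borel_measurable M \<Longrightarrow> AE x in M. \<bar>f x\<bar> \<le> C \<Longrightarrow> ae_bounded M f"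
  by (auto simp: ae_bounded_def)

lemma ae_bounded_add:
  assumes "ae_bounded M f" "ae_bounded M g"
  shows "ae_bounded M (\<lambda>x. f x + g x)"
proof -
  obtain C D where "AE x in M. \<bar>f x\<bar> \<le> C" "AE x in M. \<bar>g x\<bar> \<le> D"
    using assms by (auto simp: ae_bounded_def)
  then have "AE x in M. \<bar>f x + g x\<bar> \<le> C + D"
    by eventually_elim linarith
  then show ?thesis
    using assms by (auto simp: ae_bounded_def)
qed

lemma ae_bounded_mult:
  assumes "ae_bounded M f" "ae_bounded M g"
  shows "ae_bounded M (\<lambda>x. f x * g x)"
proof -
  obtain C D where "AE x in M. \<bar>f x\<bar> \<le> C" "AE x in M. \<bar>g x\<bar> \<le> D"
    using assms by (auto simp: ae_bounded_def)
  then have "AE x in M. \<bar>f x * g x\<bar> \<le> C * D"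
    by eventually_elim (auto simp: abs_mult intro!: mult_mono)
  then show ?thesis
    using assms by (auto simp: ae_bounded_def)
qed

lemma ae_bounded_const: "ae_bounded M (\<lambda>x. c)"
  by (rule ae_boundedI[where C = "\<bar>c\<bar>"]) simp_all

lemma ae_bounded_power: "ae_bounded M f \<Longrightarrow> ae_bounded M (\<lambda>x. f x ^ k)"
  by (induction k) (simp_all add: ae_bounded_const ae_bounded_mult)

lemma ae_bounded_sum: "(\<And>i. i \<in> I \<Longrightarrow> ae_bounded M (f i)) \<Longrightarrow> ae_bounded M (\<lambda>x. \<Sum>i\<in>I. f i x)"
  by (induction I rule: infinite_finite_induct) (simp_all add: ae_bounded_const ae_bounded_add)

lemma (in finite_measure) integrable_ae_bounded: "ae_bounded M f \<Longrightarrow> integrable M f"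
  unfolding ae_bounded_def by (auto intro!: integrable_const_bound[of f])

text \<open>Each summand raises the root of the bound by \<open>4 * b\<close>, so the fourth moment
  grows like the square of \<open>N\<close>, not its fourth power.\<close>

lemma (in finite_measure) fourth_moment_sum:
  fixes X :: "nat \<Rightarrow> 'a \<Rightarrow> real"
  assumes N: "N \<ge> 1" and b: "b > 0"
    and bdd: "\<And>m. m \<in> {1..N} \<Longrightarrow> ae_bounded M (X m)"
    and X4: "\<And>m. m \<in> {1..N} \<Longrightarrow> (\<integral>x. X m x ^ 4 \<partial>M) \<le> b\<^sup>2"
    and orth: "\<And>m. m \<in> {1..<N} \<Longrightarrow> (\<integral>x. (\<Sum>k\<in>{1..m}. X k x) ^ 3 * X (Suc m) x \<partial>M) = 0"
  shows "(\<integral>x. (\<Sum>m\<in>{1..N}. X m x) ^ 4 \<partial>M) \<le> (4 * real N * b)\<^sup>2"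
  using N bdd X4 orth
proof (induction N rule: nat_induct_at_least)
  case base
  have "(\<integral>x. X 1 x ^ 4 \<partial>M) \<le> b\<^sup>2"
    using base by simp
  also have "\<dots> \<le> (4 * real 1 * b)\<^sup>2"
    using b by (simp add: power_mult_distrib)
  finally show ?case by simp
next
  case (Suc N)
  define Y where "Y x = (\<Sum>m\<in>{1..N}. X m x)" for x
  have Y: "ae_bounded M Y"
    unfolding Y_def using Suc.prems(1) by (intro ae_bounded_sum) auto
  have X: "ae_bounded M (X (Suc N))"
    using Suc.prems(1) by simp
  have "(\<integral>x. (Y x + X (Suc N) x) ^ 4 \<partial>M) \<le> (4 * real N * b + 4 * b)\<^sup>2"
  proof (rule fourth_moment_add)
    show "(\<integral>x. Y x ^ 4 \<partial>M) \<le> (4 * real N * b)\<^sup>2"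
      unfolding Y_def using Suc.prems by (intro Suc.IH) auto
    show "(\<integral>x. X (Suc N) x ^ 4 \<partial>M) \<le> b\<^sup>2"
      using Suc.prems(2) by simp
    show "(\<integral>x. Y x ^ 3 * X (Suc N) x \<partial>M) = 0"
      unfolding Y_def using Suc.prems(3) Suc.hyps by simp
  qed (use X Y Suc.hyps b in \<open>auto intro!: integrable_ae_bounded ae_bounded_power ae_bounded_mult ae_bounded_add\<close>)
  moreover have "Y x + X (Suc N) x = (\<Sum>m\<in>{1..Suc N}. X m x)" for x
    by (simp add: Y_def)
  ultimately show ?case
    by (simp add: algebra_simps)
qed

text \<open>Enlarging \<open>Q\<close> one coordinate at a time reduces moment bounds for multi-indexed sums and maxima
  to one-parameter ones.\<close>

definition slice :: "('d::finite \<Rightarrow> nat) \<Rightarrow> 'd set \<Rightarrow> ('d \<Rightarrow> nat) \<Rightarrow> ('d \<Rightarrow> nat) set" where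
  "slice n Q i = {j \<in> {1..n}. \<forall>r. r \<notin> Q \<longrightarrow> j r = i r}"

lemma finite_slice: "finite (slice n Q i)"
  unfolding slice_def using finite_multi_box by (rule finite_subset[rotated]) auto

lemma slice_empty: "i \<in> {1..n} \<Longrightarrow> slice n {} i = {i}"
  by (auto simp: slice_def)

lemma slice_UNIV: "slice n UNIV i = {1..n}"
  by (auto simp: slice_def)

lemma slice_insert:
  assumes "q \<notin> Q" "m \<in> {1..n q}"
  shows "{j \<in> slice n (insert q Q) i. j q = m} = slice n Q (i(q := m))"
  using assms by (fastforce simp: slice_def)

lemma sum_slice_insert:
  assumes "q \<notin> Q"
  shows "(\<Sum>j\<in>slice n (insert q Q) i. f j) = (\<Sum>m\<in>{1..n q}. \<Sum>j\<in>slice n Q (i(q := m)). f j)"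
proof -
  have "(\<Sum>m\<in>{1..n q}. \<Sum>j\<in>{j \<in> slice n (insert q Q) i. j q = m}. f j) = (\<Sum>j\<in>slice n (insert q Q) i. f j)"
  proof (rule sum.group[OF finite_slice])
    show "(\<lambda>j. j q) ` slice n (insert q Q) i \<subseteq> {1..n q}"
      by (auto simp: slice_def le_fun_def)
  qed simp
  moreover have "(\<Sum>m\<in>{1..n q}. \<Sum>j\<in>{j \<in> slice n (insert q Q) i. j q = m}. f j) =
      (\<Sum>m\<in>{1..n q}. \<Sum>j\<in>slice n Q (i(q := m)). f j)"
    by (intro sum.cong slice_insert assms refl)
  ultimately show ?thesis
    by simp
qed

context commuting_prob_space
begin

text \<open>When \<open>q\<close> joins \<open>Q\<close>, the sums over the levels of coordinate
  \<open>q\<close> are increments of a one-parameter martingale, and their fourth moments are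
  bounded by the induction hypothesis. Each coordinate thus costs a factor
  \<open>4 * n q\<close>.\<close>

lemma ortho_diffs_fourth_moment_slice:
  assumes G: "ortho_diffs G" and B: "B > 0"
    and bdd: "\<And>i. i \<in> {1..n} \<Longrightarrow> AE x in P. \<bar>G i x\<bar> \<le> B"
    and i: "i \<in> {1..n}"
  shows "(\<integral>x. (\<Sum>j\<in>slice n Q i. G j x) ^ 4 \<partial>P) \<le> (4 ^ card Q * B\<^sup>2 * (\<Prod>r\<in>Q. real (n r)))\<^sup>2"
  using finite[of Q] i
proof (induction Q arbitrary: i rule: finite_induct)
  case empty
  have "(\<integral>x. G i x ^ 4 \<partial>P) \<le> (\<integral>x. B ^ 4 \<partial>P)"
  proof (rule integral_mono_AE)
    have "1 \<le> i"
      using empty by (meson atLeastAtMost_iff)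
    then show "integrable P (\<lambda>x. G i x ^ 4)"
      by (intro integrable_ae_bounded ae_bounded_power ae_boundedI[OF _ bdd[OF empty]] ortho_diffsD(3)[OF G])
    show "AE x in P. G i x ^ 4 \<le> B ^ 4"
      using bdd[OF empty] by eventually_elim (metis power_mono_even even_numeral abs_of_pos B)
  qed simp
  also have "\<dots> = (B\<^sup>2)\<^sup>2"
    by (simp add: prob_space)
  finally show ?case
    by (simp add: slice_empty[OF empty])
next
  case (insert q Q)
  define X where "X m x = (\<Sum>j\<in>slice n Q (i(q := m)). G j x)" for m x
  define b where "b = 4 ^ card Q * B\<^sup>2 * (\<Prod>r\<in>Q. real (n r))"
  have n: "1 \<le> n"
    using insert.prems by (meson atLeastAtMost_iff order_trans)
  have G_bdd: "ae_bounded P (G j)" if "j \<in> slice n Q' i'" for j Q' i'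
    using that ortho_diffsD(3)[OF G, of j] bdd[of j] by (intro ae_boundedI) (auto simp: slice_def)
  have n1: "1 \<le> n r" for r
    using n by (simp add: le_fun_def)
  have box: "i(q := m) \<in> {1..n}" if "m \<in> {1..n q}" for m
    using insert.prems that by (auto simp: le_fun_def)
  have "(\<integral>x. (\<Sum>m\<in>{1..n q}. X m x) ^ 4 \<partial>P) \<le> (4 * real (n q) * b)\<^sup>2"
  proof (rule fourth_moment_sum)
    show "b > 0"
      unfolding b_def using B n1 by (intro mult_pos_pos prod_pos) (auto simp: Suc_le_eq)
    show "ae_bounded P (X m)" for m
      unfolding X_def by (intro ae_bounded_sum G_bdd)
    show "(\<integral>x. X m x ^ 4 \<partial>P) \<le> b\<^sup>2" if "m \<in> {1..n q}" for m
      unfolding X_def b_def by (rule insert.IH[OF box[OF that]])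
    fix m assume m: "m \<in> {1..<n q}"
    define Y where "Y x = (\<Sum>k\<in>{1..m}. X k x) ^ 3" for x
    have Ybdd: "ae_bounded P Y"
      unfolding Y_def X_def by (intro ae_bounded_power ae_bounded_sum G_bdd)
    \<comment> \<open>The sigma-algebra at \<open>n(q := m)\<close> contains everything in the box
      with coordinate \<open>q\<close> at most \<open>m\<close>, whatever the other coordinates are.
      An index with coordinate \<open>Suc m\<close> is not below \<open>n(q := m)\<close>, so its
      difference is orthogonal to \<open>Y\<close>.\<close>
    have Y: "Y \<in> borel_measurable (F (n(q := m)))"
      unfolding Y_def X_def
    proof (intro borel_measurable_power borel_measurable_sum)
      fix k j assume "k \<in> {1..m}" "j \<in> slice n Q (i(q := k))"
      then have "1 \<le> j" "j \<le> n(q := m)"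
        using insert.hyps m by (auto simp: slice_def le_fun_def)
      then show "G j \<in> borel_measurable (F (n(q := m)))"
        using ortho_diffsD(1)[OF G] measurable_F_mono by blast
    qed
    have int: "integrable P (\<lambda>x. Y x * G j x)" if "j \<in> slice n Q (i(q := Suc m))" for j
      by (intro integrable_ae_bounded ae_bounded_mult Ybdd G_bdd[OF that])
    have "(\<integral>x. Y x * X (Suc m) x \<partial>P) = (\<Sum>j\<in>slice n Q (i(q := Suc m)). \<integral>x. Y x * G j x \<partial>P)"
      unfolding X_def sum_distrib_left using int by (rule Bochner_Integration.integral_sum)
    also have "\<dots> = (\<Sum>j\<in>slice n Q (i(q := Suc m)). 0)"
    proof (intro sum.cong refl)
      fix j assume j: "j \<in> slice n Q (i(q := Suc m))"
      then have "1 \<le> j" "j q = Suc m"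
        using insert.hyps by (auto simp: slice_def)
      then show "(\<integral>x. Y x * G j x \<partial>P) = 0"
        by (intro ortho_diffs_integral_mult[OF G _ Y int[OF j]])
          (auto simp: le_fun_def intro!: exI[of _ q])
    qed
    finally show "(\<integral>x. (\<Sum>k\<in>{1..m}. X k x) ^ 3 * X (Suc m) x \<partial>P) = 0"
      by (simp add: Y_def)
  qed (use n1 in auto)
  then show ?case
    using insert.hyps by (simp add: sum_slice_insert X_def b_def mult_ac)
qed

lemma ortho_diffs_fourth_moment:
  assumes "ortho_diffs G" "B > 0" "\<And>i. i \<in> {1..n} \<Longrightarrow> AE x in P. \<bar>G i x\<bar> \<le> B" "1 \<le> n"
  shows "(\<integral>x. (\<Sum>i\<in>{1..n}. G i x) ^ 4 \<partial>P) \<le> (4 ^ CARD('d) * B\<^sup>2 * real (\<Prod>q\<in>UNIV. n q))\<^sup>2"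
  using ortho_diffs_fourth_moment_slice[OF assms(1-3), of n n UNIV] assms(4) by (simp add: slice_UNIV)

end

section \<open>Maximal inequalities\<close>

text \<open>Integrating the pathwise bound gives second moments directly, bypassing the weak-type
  inequality and the layer-cake formula.\<close>

lemma (in finite_measure) doob_L2_maximal:
  fixes V :: "nat \<Rightarrow> 'a \<Rightarrow> real"
  assumes N: "N \<ge> 1"
    and sub: "\<And>m. subalgebra M (G m)"
    and mono: "\<And>k m. k \<le> m \<Longrightarrow> subalgebra (G m) (G k)"
    and V: "\<And>m. m \<in> {1..N} \<Longrightarrow> V m \<in> borel_measurable (G m)"
    and nonneg: "\<And>m x. m \<in> {1..N} \<Longrightarrow> V m x \<ge> 0"
    and sq: "\<And>m. m \<in> {1..N} \<Longrightarrow> integrable M (\<lambda>x. (V m x)\<^sup>2)"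
    and submart: "\<And>m. m \<in> {1..<N} \<Longrightarrow> AE x in M. V m x \<le> real_cond_exp M (G m) (V (Suc m)) x"
  shows "(\<integral>x. (MAX m\<in>{1..N}. V m x)\<^sup>2 \<partial>M) \<le> 4 * (\<integral>x. (V N x)\<^sup>2 \<partial>M)"
proof -
  define R where "R m x = (MAX k\<in>{1..m}. V k x)" for m x
  have VM: "V m \<in> borel_measurable M" if "m \<in> {1..N}" for m
    using measurable_from_subalg[OF sub V[OF that]] .
  have R_sq: "integrable M (\<lambda>x. (R m x)\<^sup>2)" if "m \<in> {1..N}" for m
    unfolding R_def using that by (intro integrable_Max_square VM sq) auto
  have RG: "R m \<in> borel_measurable (G m)" if "m \<in> {1..N}" for m
    unfolding R_def
  proof (rule borel_measurable_Max)
    fix k assume "k \<in> {1..m}"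
    then show "V k \<in> borel_measurable (G m)"
      using that by (intro measurable_from_subalg[OF mono V]) auto
  qed simp
  have RM: "R m \<in> borel_measurable M" if "m \<in> {1..N}" for m
    using measurable_from_subalg[OF sub RG[OF that]] .
  have R_nonneg: "0 \<le> R m x" if "m \<in> {1..N}" for m x
    using that nonneg[of 1 x] unfolding R_def by (subst Max_ge_iff) auto
  have int: "integrable M (\<lambda>x. R m x * V k x)" if "m \<in> {1..N}" "k \<in> {1..N}" for m k
    using that by (intro integrable_mult_square RM VM R_sq sq)
  \<comment> \<open>The running maximum is nonnegative and known at time \<open>m\<close>, so the
    submartingale inequality may be multiplied by it and integrated.\<close>
  have incr: "0 \<le> (\<integral>x. R m x * (V (Suc m) x - V m x) \<partial>M)" if m: "m \<in> {1..<N}" for m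
  proof -
    interpret sub: finite_measure_subalgebra M "G m"
      by unfold_locales (rule sub)
    have m': "m \<in> {1..N}" "Suc m \<in> {1..N}"
      using m by auto
    have "(\<integral>x. R m x * V m x \<partial>M) \<le> (\<integral>x. R m x * real_cond_exp M (G m) (V (Suc m)) x \<partial>M)"
    proof (rule integral_mono_AE)
      show "integrable M (\<lambda>x. R m x * real_cond_exp M (G m) (V (Suc m)) x)"
        by (rule sub.real_cond_exp_intg(1)[OF int[OF m'] RG[OF m'(1)] VM[OF m'(2)]])
      show "AE x in M. R m x * V m x \<le> R m x * real_cond_exp M (G m) (V (Suc m)) x"
        using submart[OF m] by eventually_elim (rule mult_left_mono[OF _ R_nonneg[OF m'(1)]])
    qed (rule int[OF m'(1) m'(1)])
    also have "\<dots> = (\<integral>x. R m x * V (Suc m) x \<partial>M)"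
      by (rule sub.real_cond_exp_intg(2)[OF int[OF m'] RG[OF m'(1)] VM[OF m'(2)]])
    finally show ?thesis
      using int[OF m'] int[OF m'(1) m'(1)] by (simp add: right_diff_distrib)
  qed
  have NN: "N \<in> {1..N}"
    using N by simp
  have int_incr: "integrable M (\<lambda>x. R m x * (V (Suc m) x - V m x))" if "m \<in> {1..<N}" for m
    using that int[of m m] int[of m "Suc m"] by (simp add: right_diff_distrib)
  have int_sum: "integrable M (\<lambda>x. \<Sum>m\<in>{1..<N}. R m x * (V (Suc m) x - V m x))"
    using int_incr by (rule Bochner_Integration.integrable_sum)
  have "(\<integral>x. (R N x)\<^sup>2 \<partial>M) \<le> (\<integral>x. 4 * (V N x)\<^sup>2 - 4 * (\<Sum>m\<in>{1..<N}. R m x * (V (Suc m) x - V m x)) \<partial>M)"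
  proof (rule integral_mono)
    fix x
    have "(R N x)\<^sup>2 + 2 * (\<Sum>m\<in>{1..<N}. R m x * (V (Suc m) x - V m x)) \<le> 2 * R N x * V N x"
      unfolding R_def by (rule running_max_square_bound[OF N])
    \<comment> \<open>Source of the constant 4: \<open>4 * R * V\<close> is at most
      \<open>R^2 + 4 * V^2\<close>, and one \<open>R^2\<close> is absorbed on the left.\<close>
    moreover have "0 \<le> (R N x - 2 * V N x)\<^sup>2"
      by simp
    ultimately show "(R N x)\<^sup>2 \<le> 4 * (V N x)\<^sup>2 - 4 * (\<Sum>m\<in>{1..<N}. R m x * (V (Suc m) x - V m x))"
      by (simp add: power2_eq_square algebra_simps)
  qed (use int_sum R_sq[OF NN] sq[OF NN] in auto)
  also have "\<dots> = 4 * (\<integral>x. (V N x)\<^sup>2 \<partial>M) - 4 * (\<Sum>m\<in>{1..<N}. \<integral>x. R m x * (V (Suc m) x - V m x) \<partial>M)"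
    using int_sum int_incr sq[OF NN] by (simp flip: Bochner_Integration.integral_sum)
  also have "\<dots> \<le> 4 * (\<integral>x. (V N x)\<^sup>2 \<partial>M)"
    using sum_nonneg[of "{1..<N}" "\<lambda>m. \<integral>x. R m x * (V (Suc m) x - V m x) \<partial>M", OF incr] by linarith
  finally show ?thesis
    by (simp add: R_def)
qed

context commuting_prob_space
begin

text \<open>Cairoli's iteration: the maximum over the coordinates in \<open>Q\<close> is a one-parameter
  submartingale in each remaining coordinate.\<close>

lemma cairoli_L2_maximal_slice:
  fixes Z :: "('d \<Rightarrow> nat) \<Rightarrow> 'a \<Rightarrow> real"
  assumes n: "1 \<le> n"
    and Z: "\<And>j. j \<in> {1..n} \<Longrightarrow> Z j \<in> borel_measurable (F j)"
    and nonneg: "\<And>j x. j \<in> {1..n} \<Longrightarrow> Z j x \<ge> 0"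
    and sq: "\<And>j. j \<in> {1..n} \<Longrightarrow> integrable P (\<lambda>x. (Z j x)\<^sup>2)"
    and submart: "\<And>j k. j \<in> {1..n} \<Longrightarrow> k \<in> {1..n} \<Longrightarrow> AE x in P. Z (inf j k) x \<le> real_cond_exp P (F k) (Z j) x"
  shows "(\<integral>x. (MAX j\<in>slice n Q n. Z j x)\<^sup>2 \<partial>P) \<le> 4 ^ card Q * (\<integral>x. (Z n x)\<^sup>2 \<partial>P)"
  using finite[of Q]
proof (induction Q rule: finite_induct)
  case empty
  have "n \<in> {1..n}"
    using n by (meson atLeastAtMost_iff order_refl)
  then show ?case
    by (simp add: slice_empty)
next
  case (insert q Q)
  \<comment> \<open>Since \<open>q\<close> is not in \<open>Q\<close>, \<open>slice n Q n\<close>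
    pins coordinate \<open>q\<close> at \<open>n q\<close>; the update moves the whole slice to
    level \<open>m\<close>.\<close>
  define V where "V m x = (MAX j\<in>slice n Q n. Z (j(q := m)) x)" for m x
  let ?n = "\<lambda>m. n(q := m)"
  have n1: "1 \<le> n r" for r
    using n by (simp add: le_fun_def)
  have n_slice: "n \<in> slice n Q n" for Q
    using n by (simp add: slice_def)
  have box: "j(q := m) \<in> {1..n}" if "j \<in> slice n Q n" "m \<in> {1..n q}" for j m
    using that by (auto simp: le_fun_def slice_def)
  have nbox: "?n m \<in> {1..n}" if "m \<in> {1..n q}" for m
    using box[OF n_slice that] .
  have ZP: "Z j \<in> borel_measurable P" if "j \<in> {1..n}" for j
    using measurable_F_P[OF Z[OF that]] .
  have Zint: "integrable P (Z j)" if "j \<in> {1..n}" for j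
    by (rule integrable_of_square[OF ZP[OF that] sq[OF that]])
  have VP: "V m \<in> borel_measurable P" if "m \<in> {1..n q}" for m
    unfolding V_def by (intro borel_measurable_Max finite_slice ZP box that)
  have Vsq: "integrable P (\<lambda>x. (V m x)\<^sup>2)" if "m \<in> {1..n q}" for m
    unfolding V_def using n_slice by (intro integrable_Max_square finite_slice ZP sq box that) auto
  have nonempty: "slice n Q n \<noteq> {}" for Q
    using n_slice by auto
  have "(\<integral>x. (MAX m\<in>{1..n q}. V m x)\<^sup>2 \<partial>P) \<le> 4 * (\<integral>x. (V (n q) x)\<^sup>2 \<partial>P)"
  proof (rule doob_L2_maximal[where G = "\<lambda>m. F (?n m)"])
    show "1 \<le> n q"
      by (rule n1)
    show "subalgebra P (F (?n m))" for m
      by (rule subalgebra_F)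
    show "subalgebra (F (?n m)) (F (?n k))" if "k \<le> m" for k m
      using that by (intro subalgebra_F_mono) (simp add: le_fun_def)
    show "V m \<in> borel_measurable (F (?n m))" if m: "m \<in> {1..n q}" for m
      unfolding V_def
    proof (rule borel_measurable_Max)
      fix j assume j: "j \<in> slice n Q n"
      then have "j(q := m) \<le> ?n m"
        by (auto simp: slice_def le_fun_def)
      then show "Z (j(q := m)) \<in> borel_measurable (F (?n m))"
        by (rule measurable_F_mono[OF Z[OF box[OF j m]]])
    qed (rule finite_slice)
    show "0 \<le> V m x" if m: "m \<in> {1..n q}" for m x
      unfolding V_def
      by (subst Max_ge_iff) (use nonempty finite_slice nonneg[OF box[OF n_slice m]] n_slice in blast)+
    show "integrable P (\<lambda>x. (V m x)\<^sup>2)" if "m \<in> {1..n q}" for m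
      by (rule Vsq[OF that])
    fix m assume "m \<in> {1..<n q}"
    then have m: "m \<in> {1..n q}" "Suc m \<in> {1..n q}"
      by auto
    have "AE x in P. Z (j(q := m)) x \<le> real_cond_exp P (F (?n m)) (V (Suc m)) x" if j: "j \<in> slice n Q n" for j
    proof -
      \<comment> \<open>Conditioning at \<open>n(q := m)\<close> lowers coordinate \<open>q\<close>
        and no other, so \<open>submart\<close> compares consecutive levels along the same
        \<open>j\<close>.\<close>
      have "inf (j(q := Suc m)) (?n m) = j(q := m)"
        using j by (auto simp: fun_eq_iff slice_def le_fun_def inf_nat_def)
      then have "AE x in P. Z (j(q := m)) x \<le> real_cond_exp P (F (?n m)) (Z (j(q := Suc m))) x"
        using submart[OF box[OF j m(2)] nbox[OF m(1)]] by simp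
      moreover have "AE x in P. real_cond_exp P (F (?n m)) (Z (j(q := Suc m))) x \<le> real_cond_exp P (F (?n m)) (V (Suc m)) x"
      proof (rule real_cond_exp_mono)
        show "AE x in P. Z (j(q := Suc m)) x \<le> V (Suc m) x"
          unfolding V_def using j by (intro AE_I2 Max_ge) (auto simp: finite_slice)
      qed (use Zint[OF box[OF j m(2)]] integrable_of_square[OF VP Vsq, OF m(2) m(2)] in auto)
      ultimately show ?thesis
        by eventually_elim simp
    qed
    then have "AE x in P. \<forall>j\<in>slice n Q n. Z (j(q := m)) x \<le> real_cond_exp P (F (?n m)) (V (Suc m)) x"
      by (intro AE_finite_allI finite_slice)
    then show "AE x in P. V m x \<le> real_cond_exp P (F (?n m)) (V (Suc m)) x"
    proof eventually_elim
      case (elim x)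
      then show ?case
        unfolding V_def using nonempty by (subst Max_le_iff) (auto simp: finite_slice)
    qed
  qed
  also have "(\<lambda>x. V (n q) x) = (\<lambda>x. MAX j\<in>slice n Q n. Z j x)"
  proof -
    have "j(q := n q) = j" if "j \<in> slice n Q n" for j
      using that insert.hyps by (auto simp: slice_def)
    then show ?thesis
      by (simp add: V_def cong: image_cong_simp)
  qed
  also have "4 * (\<integral>x. (MAX j\<in>slice n Q n. Z j x)\<^sup>2 \<partial>P) \<le> 4 * (4 ^ card Q * (\<integral>x. (Z n x)\<^sup>2 \<partial>P))"
    using insert.IH by simp
  also have "(\<lambda>x. MAX m\<in>{1..n q}. V m x) = (\<lambda>x. MAX j\<in>slice n (insert q Q) n. Z j x)"
  proof
    fix x
    show "(MAX m\<in>{1..n q}. V m x) = (MAX j\<in>slice n (insert q Q) n. Z j x)" (is "?L = ?R")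
    proof (rule antisym)
      have "Z (j(q := m)) x \<le> ?R" if "j \<in> slice n Q n" "m \<in> {1..n q}" for j m
      proof (rule Max_ge)
        have "j(q := m) \<in> slice n (insert q Q) n"
          using box[OF that] that(1) by (simp add: slice_def)
        then show "Z (j(q := m)) x \<in> (\<lambda>j. Z j x) ` slice n (insert q Q) n"
          by (rule imageI)
      qed (simp add: finite_slice)
      then have "V m x \<le> ?R" if "m \<in> {1..n q}" for m
        unfolding V_def using that nonempty by (subst Max_le_iff) (auto simp: finite_slice)
      then show "?L \<le> ?R"
        using n1 by (subst Max_le_iff) auto
    next
      have "Z j x \<le> ?L" if j: "j \<in> slice n (insert q Q) n" for j
      proof -
        have jq: "j q \<in> {1..n q}"
          using j by (auto simp: slice_def le_fun_def)
        \<comment> \<open>Every point of the larger slice comes from its copy at level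
          \<open>n q\<close> by resetting coordinate \<open>q\<close>.\<close>
        have "j(q := n q) \<in> slice n Q n"
          using j n by (auto simp: slice_def le_fun_def)
        then have "Z ((j(q := n q))(q := j q)) x \<le> V (j q) x"
          unfolding V_def by (rule Max_ge[OF finite_imageI[OF finite_slice] rev_image_eqI[OF _ refl]])
        also have "V (j q) x \<le> ?L"
          using jq by (intro Max_ge imageI) auto
        finally show ?thesis by simp
      qed
      then show "?R \<le> ?L"
        using nonempty by (subst Max_le_iff) (auto simp: finite_slice)
    qed
  qed
  finally show ?case
    using insert.hyps by simp
qed

text \<open>By Jensen, \<open>\<phi>\<close> of the partial sums satisfies the submartingale
  condition of Cairoli's iteration. Because of the outer square, the choice of squaring for
  \<open>\<phi>\<close> controls fourth moments, the absolute value second moments.\<close>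

lemma ortho_diffs_maximal:
  assumes G: "ortho_diffs G" and n: "1 \<le> n"
    and phi: "convex_on UNIV \<phi>" "\<phi> \<in> borel_measurable borel" "\<And>t. 0 \<le> \<phi> t"
    and sq: "\<And>j. j \<in> {1..n} \<Longrightarrow> integrable P (\<lambda>x. (\<phi> (\<Sum>i\<in>{1..j}. G i x))\<^sup>2)"
  shows "(\<integral>x. (MAX j\<in>{1..n}. \<phi> (\<Sum>i\<in>{1..j}. G i x))\<^sup>2 \<partial>P)
    \<le> 4 ^ CARD('d) * (\<integral>x. (\<phi> (\<Sum>i\<in>{1..n}. G i x))\<^sup>2 \<partial>P)"
proof -
  define S where "S j x = (\<Sum>i\<in>{1..j}. G i x)" for j x
  have SF: "S j \<in> borel_measurable (F j)" for j
    unfolding S_def by (rule ortho_diffs_sum_measurable[OF G]) simp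
  have phiF: "(\<lambda>x. \<phi> (S j x)) \<in> borel_measurable (F j)" for j
    using measurable_compose[OF SF phi(2)] .
  have Sint: "integrable P (S j)" for j
    unfolding S_def
    by (intro Bochner_Integration.integrable_sum ortho_diffsD(2)[OF G]) (meson atLeastAtMost_iff)
  have phi_int: "integrable P (\<lambda>x. \<phi> (S j x))" if "j \<in> {1..n}" for j
    by (rule integrable_of_square[OF measurable_F_P[OF phiF]]) (use sq[OF that] in \<open>simp add: S_def\<close>)
  have "(\<integral>x. (MAX j\<in>slice n UNIV n. \<phi> (S j x))\<^sup>2 \<partial>P) \<le> 4 ^ card (UNIV::'d set) * (\<integral>x. (\<phi> (S n x))\<^sup>2 \<partial>P)"
  proof (rule cairoli_L2_maximal_slice[OF n])
    fix j k assume j: "j \<in> {1..n}"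
    have "AE x in P. real_cond_exp P (F k) (S j) x = S (inf j k) x"
      using ortho_diffs_sum_cond_exp[OF G, of k j] by (simp add: S_def[abs_def])
    moreover have "AE x in P. \<phi> (real_cond_exp P (F k) (S j) x) \<le> real_cond_exp P (F k) (\<lambda>x. \<phi> (S j x)) x"
      by (rule real_cond_exp_jensens_inequality(2)[where I = UNIV, OF Sint _ _ phi_int[OF j] phi(1,2)]) simp_all
    ultimately show "AE x in P. \<phi> (S (inf j k) x) \<le> real_cond_exp P (F k) (\<lambda>x. \<phi> (S j x)) x"
      by eventually_elim simp
  next
    show "integrable P (\<lambda>x. (\<phi> (S j x))\<^sup>2)" if "j \<in> {1..n}" for j
      using sq[OF that] by (simp add: S_def)
  qed (rule phiF phi(3))+
  then show ?thesis
    by (simp add: S_def slice_UNIV)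
qed

end

section \<open>Projection onto orthomartingale differences\<close>

context commuting_prob_space
begin

text \<open>For \<open>1 \<le> i\<close> the subtraction is exact; it may reach zero coordinates,
  where the filtration is still defined.\<close>

definition shift_down :: "'d set \<Rightarrow> ('d \<Rightarrow> nat) \<Rightarrow> 'd \<Rightarrow> nat" where
  "shift_down S i q = (if q \<in> S then i q - 1 else i q)"

text \<open>The product over the coordinates \<open>q\<close> of the differences \<open>E[\<sqdot> | F i] - E[\<sqdot> | F (i - e\<^sub>q)]\<close>, multiplied out.\<close>

definition diff_proj :: "('d \<Rightarrow> nat) \<Rightarrow> ('a \<Rightarrow> real) \<Rightarrow> 'a \<Rightarrow> real" where
  "diff_proj i T x = (\<Sum>S\<in>Pow UNIV. (-1) ^ card S * real_cond_exp P (F (shift_down S i)) T x)"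

lemma shift_down_le: "shift_down S i \<le> i"
  by (simp add: shift_down_def le_fun_def)

lemma diff_proj_measurable: "diff_proj i T \<in> borel_measurable (F i)"
  unfolding diff_proj_def
  by (intro borel_measurable_sum borel_measurable_times borel_measurable_const
      measurable_F_mono[OF borel_measurable_cond_exp shift_down_le])

lemma diff_proj_integrable: "integrable P T \<Longrightarrow> integrable P (diff_proj i T)"
  unfolding diff_proj_def by (intro Bochner_Integration.integrable_sum integrable_mult_right real_cond_exp_int)

text \<open>If \<open>k q < i q\<close>, lowering coordinate \<open>q\<close> of \<open>i\<close>
  does not change its infimum with \<open>k\<close>. After commutation the terms for
  \<open>S\<close> and \<open>insert q S\<close> therefore cancel.\<close>

lemma ortho_diffs_diff_proj:
  assumes T: "\<And>i. 1 \<le> i \<Longrightarrow> integrable P (T i)"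
  shows "ortho_diffs (\<lambda>i. diff_proj i (T i))"
  unfolding ortho_diffs_def
proof (intro allI impI conjI)
  fix i k :: "'d \<Rightarrow> nat" assume i: "1 \<le> i" and ik: "\<not> i \<le> k"
  let ?E = "\<lambda>j. real_cond_exp P (F j)"
  obtain q where q: "k q < i q"
    using ik by (auto simp: le_fun_def not_le)
  have "AE x in P. ?E k (\<lambda>x. (-1) ^ card S * ?E (shift_down S i) (T i) x) x = (-1) ^ card S * ?E (inf k (shift_down S i)) (T i) x" for S
    using real_cond_exp_cmult[where i = k and c = "(-1) ^ card S", OF real_cond_exp_int(1)[where i = "shift_down S i", OF T[OF i]]]
      cond_exp_commute[OF T[OF i], of k "shift_down S i"]
    by eventually_elim simp
  then have "AE x in P. \<forall>S\<in>Pow UNIV. ?E k (\<lambda>x. (-1) ^ card S * ?E (shift_down S i) (T i) x) x = (-1) ^ card S * ?E (inf k (shift_down S i)) (T i) x"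
    by (intro AE_finite_allI) auto
  moreover have "AE x in P. ?E k (\<lambda>x. \<Sum>S\<in>Pow UNIV. (-1) ^ card S * ?E (shift_down S i) (T i) x) x
      = (\<Sum>S\<in>Pow UNIV. ?E k (\<lambda>x. (-1) ^ card S * ?E (shift_down S i) (T i) x) x)"
    by (rule cond_exp_sum) (intro integrable_mult_right real_cond_exp_int T i)
  ultimately show "AE x in P. ?E k (diff_proj i (T i)) x = 0"
  proof eventually_elim
    case (elim x)
    have "(\<Sum>S\<in>Pow UNIV. (-1) ^ card S * ?E (inf k (shift_down S i)) (T i) x) = 0"
    proof (rule alternating_sum_eq_0)
      fix S assume "S \<subseteq> UNIV - {q}"
      have "inf k (shift_down (insert q S) i) = inf k (shift_down S i)"
        using q by (auto simp: fun_eq_iff shift_down_def inf_nat_def)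
      then show "?E (inf k (shift_down (insert q S) i)) (T i) x = ?E (inf k (shift_down S i)) (T i) x"
        by simp
    qed simp_all
    with elim show ?case
      by (simp add: diff_proj_def[abs_def])
  qed
qed (auto intro: diff_proj_measurable diff_proj_integrable T)

lemma diff_proj_add:
  assumes "integrable P f" "integrable P g"
  shows "AE x in P. diff_proj i (\<lambda>x. f x + g x) x = diff_proj i f x + diff_proj i g x"
proof -
  have "AE x in P. \<forall>S\<in>Pow UNIV. real_cond_exp P (F (shift_down S i)) (\<lambda>x. f x + g x) x =
      real_cond_exp P (F (shift_down S i)) f x + real_cond_exp P (F (shift_down S i)) g x"
    by (intro AE_finite_allI real_cond_exp_add assms) auto
  then show ?thesis
    by eventually_elim (simp add: diff_proj_def sum.distrib distrib_left)
qed

text \<open>Every nonempty \<open>S\<close> lowers a coordinate of \<open>i\<close>, which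
  annihilates \<open>G i\<close>; only the empty set survives. This makes the two projected
  truncations add up to the original difference.\<close>

lemma diff_proj_ortho_diffs:
  assumes G: "ortho_diffs G" and i: "1 \<le> i"
  shows "AE x in P. diff_proj i (G i) x = G i x"
proof -
  have "AE x in P. real_cond_exp P (F (shift_down S i)) (G i) x = (if S = {} then G i x else 0)" for S
  proof (cases "S = {}")
    case True
    then have "shift_down S i = i"
      by (simp add: shift_down_def fun_eq_iff)
    then show ?thesis
      using True real_cond_exp_F_meas[OF ortho_diffsD(2,1)[OF G i]] by simp
  next
    case False
    then obtain q where "q \<in> S" by auto
    moreover have "1 \<le> i q"
      using i by (simp add: le_fun_def)
    ultimately have "\<not> i \<le> shift_down S i"
      by (auto simp: le_fun_def shift_down_def intro!: exI[of _ q])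
    then show ?thesis
      using False ortho_diffsD(4)[OF G i] by simp
  qed
  then have "AE x in P. \<forall>S\<in>Pow UNIV. real_cond_exp P (F (shift_down S i)) (G i) x = (if S = {} then G i x else 0)"
    by (intro AE_finite_allI) auto
  then show ?thesis
  proof eventually_elim
    case (elim x)
    then have "diff_proj i (G i) x = (\<Sum>S\<in>Pow (UNIV::'d set). if S = {} then G i x else 0)"
      unfolding diff_proj_def by (intro sum.cong) auto
    then show ?case by simp
  qed
qed

lemma diff_proj_bound:
  assumes T: "integrable P T" and A: "AE x in P. \<bar>T x\<bar> \<le> A"
  shows "AE x in P. \<bar>diff_proj i T x\<bar> \<le> 2 ^ CARD('d) * A"
proof -
  have "AE x in P. \<bar>real_cond_exp P (F j) T x\<bar> \<le> A" for j
  proof -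
    have "AE x in P. - A \<le> real_cond_exp P (F j) T x"
      by (rule real_cond_exp_ge_c[OF T]) (use A in \<open>auto elim!: eventually_mono\<close>)
    moreover have "AE x in P. real_cond_exp P (F j) T x \<le> A"
      by (rule real_cond_exp_le_c[OF T]) (use A in \<open>auto elim!: eventually_mono\<close>)
    ultimately show ?thesis
      by eventually_elim simp
  qed
  then have "AE x in P. \<forall>S\<in>Pow UNIV. \<bar>real_cond_exp P (F (shift_down S i)) T x\<bar> \<le> A"
    by (intro AE_finite_allI) auto
  then show ?thesis
  proof eventually_elim
    case (elim x)
    have "\<bar>diff_proj i T x\<bar> \<le> (\<Sum>S\<in>Pow UNIV. \<bar>(-1) ^ card S * real_cond_exp P (F (shift_down S i)) T x\<bar>)"
      unfolding diff_proj_def by (rule sum_abs)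
    also have "\<dots> \<le> (\<Sum>S\<in>Pow (UNIV::'d set). A)"
      using elim by (intro sum_mono) (simp add: abs_mult)
    finally show ?case
      by (simp only: sum_constant card_Pow[OF finite]) simp
  qed
qed

text \<open>One factor \<open>2 ^ CARD('d)\<close> comes from Cauchy-Schwarz over the subsets,
  another from their number; by Jensen each conditional expectation contracts the second
  moment.\<close>

lemma diff_proj_second_moment:
  assumes [measurable]: "T \<in> borel_measurable P" and sq: "integrable P (\<lambda>x. (T x)\<^sup>2)"
  shows "integrable P (\<lambda>x. (diff_proj i T x)\<^sup>2)"
    and "(\<integral>x. (diff_proj i T x)\<^sup>2 \<partial>P) \<le> 4 ^ CARD('d) * (\<integral>x. (T x)\<^sup>2 \<partial>P)"
proof -
  let ?E = "\<lambda>S. real_cond_exp P (F (shift_down S i)) T"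
  have T: "integrable P T"
    by (rule integrable_of_square) (use sq in auto)
  have E_sq: "integrable P (\<lambda>x. (?E S x)\<^sup>2)" for S
    by (rule integrable_convex_cond_exp[where I = UNIV, OF T _ _ sq convex_power2]) simp_all
  have "AE x in P. (?E S x)\<^sup>2 \<le> real_cond_exp P (F (shift_down S i)) (\<lambda>x. (T x)\<^sup>2) x" for S
    by (rule real_cond_exp_jensens_inequality(2)[where I = UNIV, OF T _ _ sq convex_power2]) simp_all
  then have "(\<integral>x. (?E S x)\<^sup>2 \<partial>P) \<le> (\<integral>x. real_cond_exp P (F (shift_down S i)) (\<lambda>x. (T x)\<^sup>2) x \<partial>P)" for S
    by (rule integral_mono_AE[OF E_sq real_cond_exp_int(1)[OF sq]])
  then have E_le: "(\<integral>x. (?E S x)\<^sup>2 \<partial>P) \<le> (\<integral>x. (T x)\<^sup>2 \<partial>P)" for S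
    by (simp only: real_cond_exp_int(2)[OF sq])
  show int: "integrable P (\<lambda>x. (diff_proj i T x)\<^sup>2)"
    unfolding diff_proj_def using E_sq
    by (intro integrable_sum_square) (auto simp: power_mult_distrib)
  have "(diff_proj i T x)\<^sup>2 \<le> 2 ^ CARD('d) * (\<Sum>S\<in>Pow UNIV. (?E S x)\<^sup>2)" for x
  proof -
    have "(diff_proj i T x)\<^sup>2 \<le> (\<Sum>S\<in>Pow (UNIV::'d set). ((-1) ^ card S)\<^sup>2) * (\<Sum>S\<in>Pow UNIV. (?E S x)\<^sup>2)"
      unfolding diff_proj_def by (rule Cauchy_Schwarz_ineq_sum)
    also have "(\<Sum>S\<in>Pow (UNIV::'d set). ((-1) ^ card S)\<^sup>2) = (\<Sum>S\<in>Pow (UNIV::'d set). 1 :: real)"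
      by (intro sum.cong refl) (simp flip: power_mult)
    also have "\<dots> = 2 ^ CARD('d)"
      by (simp only: sum_constant card_Pow[OF finite]) simp
    finally show ?thesis .
  qed
  then have "(\<integral>x. (diff_proj i T x)\<^sup>2 \<partial>P) \<le> (\<integral>x. 2 ^ CARD('d) * (\<Sum>S\<in>Pow UNIV. (?E S x)\<^sup>2) \<partial>P)"
    using int E_sq by (intro integral_mono) auto
  also have "\<dots> = 2 ^ CARD('d) * (\<Sum>S\<in>Pow UNIV. \<integral>x. (?E S x)\<^sup>2 \<partial>P)"
    using E_sq by simp
  also have "\<dots> \<le> 2 ^ CARD('d) * (\<Sum>S\<in>Pow (UNIV::'d set). \<integral>x. (T x)\<^sup>2 \<partial>P)"
    by (intro mult_left_mono sum_mono E_le) simp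
  also have "\<dots> = 4 ^ CARD('d) * (\<integral>x. (T x)\<^sup>2 \<partial>P)"
    by (simp only: sum_constant card_Pow[OF finite]) (simp flip: power_mult_distrib)
  finally show "(\<integral>x. (diff_proj i T x)\<^sup>2 \<partial>P) \<le> 4 ^ CARD('d) * (\<integral>x. (T x)\<^sup>2 \<partial>P)" .
qed

text \<open>The \<open>D i\<close> are given only through their sums over boxes. Adaptedness,
  integrability and vanishing conditional expectations are recovered together, since solving for
  \<open>D n\<close> uses all three for the smaller indices.\<close>

lemma ortho_diffs_orthomartingale_differences:
  assumes M: "orthomartingale P F M" and D: "orthomartingale_differences P M D"
  shows "ortho_diffs D"
proof -
  have M_meas: "M n \<in> borel_measurable (F n)" "integrable P (M n)" if "1 \<le> n" for n
    using M that by (auto simp: orthomartingale_def)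
  have M_sum: "M n x = (\<Sum>i\<in>{1..n}. D i x)" if "1 \<le> n" "x \<in> space P" for n x
    using D that by (auto simp: orthomartingale_differences_def)
  \<comment> \<open>With a zero coordinate the box is empty, so the sum formula reproduces the zero
    convention.\<close>
  have M_ext: "zero_ext M n x = (\<Sum>i\<in>{1..n}. D i x)" if "x \<in> space P" for n x
  proof (cases "1 \<le> n")
    case True
    then have "\<not> (\<exists>q. n q = 0)"
      by (metis le_fun_def one_fun_apply not_one_le_zero)
    then show ?thesis
      unfolding zero_ext_def using M_sum[OF True that] by (simp only: if_False)
  next
    case False
    then have "{1..n} = {}"
      by (intro equals0I) (meson atLeastAtMost_iff order_trans)
    moreover have "\<exists>q. n q = 0"
      using False by (auto simp: le_fun_def not_le)
    ultimately show ?thesis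
      unfolding zero_ext_def by (simp only: if_True sum.empty)
  qed
  \<comment> \<open>The martingale property is given for comparable indices only. Inserting the
    conditional expectation at \<open>n\<close>, which fixes \<open>M n\<close>, and commuting
    reduces an arbitrary \<open>k\<close> to \<open>inf k n\<close>.\<close>
  have M_cond: "AE x in P. real_cond_exp P (F k) (M n) x = (\<Sum>i\<in>{1..inf n k}. D i x)" if n: "1 \<le> n" for n k
  proof -
    have "\<not> (\<exists>q. n q = 0)"
      using n by (metis le_fun_def one_fun_apply not_one_le_zero)
    then have ext: "zero_ext M n = M n"
      unfolding zero_ext_def by (simp only: if_False)
    have Mn [measurable]: "M n \<in> borel_measurable P"
      using M_meas(2)[OF n] by simp
    have "AE x in P. real_cond_exp P (F n) (M n) x = M n x"
      using M_meas[OF n] by (intro real_cond_exp_F_meas)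
    then have "AE x in P. real_cond_exp P (F k) (real_cond_exp P (F n) (M n)) x = real_cond_exp P (F k) (M n) x"
      by (rule real_cond_exp_cong) simp_all
    moreover have "AE x in P. real_cond_exp P (F (inf k n)) (M n) x = zero_ext M (inf k n) x"
      using M ext unfolding orthomartingale_def by (metis inf_le2)
    moreover note cond_exp_commute[OF M_meas(2)[OF n], of k n] AE_space
    ultimately show ?thesis
    proof eventually_elim
      case (elim x)
      then show ?case
        using M_ext[of x "inf n k"] by (simp add: inf_commute)
    qed
  qed
  \<comment> \<open>The sum of the coordinates is a natural-number rank that strictly decreases on
    the box below \<open>n\<close> away from \<open>n\<close>.\<close>
  have "D n \<in> borel_measurable (F n) \<and> integrable P (D n) \<and>
     (\<forall>k. \<not> n \<le> k \<longrightarrow> (AE x in P. real_cond_exp P (F k) (D n) x = 0))" if "1 \<le> n" for n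
    using that
  proof (induction "\<Sum>q\<in>UNIV. n q" arbitrary: n rule: less_induct)
    case (less n)
    let ?I = "{1..n} - {n}"
    have n: "n \<in> {1..n}"
      using less.prems by (meson atLeastAtMost_iff order_refl)
    have IH: "D j \<in> borel_measurable (F j)" "integrable P (D j)"
      "\<And>k. \<not> j \<le> k \<Longrightarrow> AE x in P. real_cond_exp P (F k) (D j) x = 0" if "j \<in> ?I" for j
    proof -
      have j: "1 \<le> j" "j \<le> n" "j \<noteq> n"
        using that by (blast dest: atLeastAtMost_iff[THEN iffD1])+
      then obtain q where "j q < n q"
        by (meson le_fun_def order.antisym not_le)
      then have "(\<Sum>q\<in>UNIV. j q) < (\<Sum>q\<in>UNIV. n q)"
        using j(2) by (intro sum_strict_mono_ex1) (auto simp: le_fun_def)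
      from less.hyps[OF this j(1)]
      show "D j \<in> borel_measurable (F j)" "integrable P (D j)"
        "\<And>k. \<not> j \<le> k \<Longrightarrow> AE x in P. real_cond_exp P (F k) (D j) x = 0"
        by auto
    qed
    define R where "R x = M n x - (\<Sum>j\<in>?I. D j x)" for x
    have D_eq: "D n x = R x" if "x \<in> space P" for x
      using M_sum[OF less.prems that] sum.remove[OF finite_multi_box n, of "\<lambda>i. D i x"] by (simp add: R_def)
    have R_int: "integrable P R"
      unfolding R_def using IH(2) M_meas(2)[OF less.prems]
      by (intro Bochner_Integration.integrable_diff Bochner_Integration.integrable_sum) auto
    have R_meas: "R \<in> borel_measurable (F n)"
      unfolding R_def
    proof (intro borel_measurable_diff borel_measurable_sum M_meas less.prems)
      fix j assume j: "j \<in> ?I"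
      then have "j \<le> n" by (blast dest: atLeastAtMost_iff[THEN iffD1])
      then show "D j \<in> borel_measurable (F n)"
        using measurable_F_mono[OF IH(1)[OF j]] by blast
    qed
    have sp: "space (F n) = space P"
      using subalgebra_F by (simp add: subalgebra_def)
    have D_meas: "D n \<in> borel_measurable (F n)"
      by (rule measurable_cong[THEN iffD2, OF _ R_meas]) (use D_eq sp in auto)
    have D_int: "integrable P (D n)"
      by (rule Bochner_Integration.integrable_cong[OF refl D_eq, THEN iffD2, OF _ R_int])
    have "AE x in P. real_cond_exp P (F k) (D n) x = 0" if k: "\<not> n \<le> k" for k
    proof -
      have "AE x in P. D n x = R x"
        using D_eq by (intro AE_I2)
      then have 1: "AE x in P. real_cond_exp P (F k) (D n) x = real_cond_exp P (F k) R x"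
        by (rule real_cond_exp_cong) (use D_int R_int in auto)
      have 2: "AE x in P. real_cond_exp P (F k) R x =
          real_cond_exp P (F k) (M n) x - real_cond_exp P (F k) (\<lambda>x. \<Sum>j\<in>?I. D j x) x"
        unfolding R_def using IH(2) M_meas(2)[OF less.prems]
        by (intro real_cond_exp_diff Bochner_Integration.integrable_sum) auto
      have 3: "AE x in P. real_cond_exp P (F k) (\<lambda>x. \<Sum>j\<in>?I. D j x) x = (\<Sum>j\<in>?I. real_cond_exp P (F k) (D j) x)"
        by (rule cond_exp_sum) (rule IH(2))
      have "AE x in P. real_cond_exp P (F k) (D j) x = (if j \<le> k then D j x else 0)" if j: "j \<in> ?I" for j
      proof (cases "j \<le> k")
        case True
        then show ?thesis
          using real_cond_exp_F_meas[OF IH(2)[OF j] measurable_F_mono[OF IH(1)[OF j]]] by simp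
      qed (use IH(3)[OF j] in simp)
      then have 4: "AE x in P. \<forall>j\<in>?I. real_cond_exp P (F k) (D j) x = (if j \<le> k then D j x else 0)"
        by (intro AE_finite_allI) (simp_all add: finite_multi_box)
      \<comment> \<open>As \<open>n\<close> is not below \<open>k\<close>, removing \<open>n\<close>
        loses nothing: the known differences already account for the whole conditional expectation
        of \<open>M n\<close>.\<close>
      have I: "?I \<inter> {j. j \<le> k} = {1..inf n k}"
        using k by auto
      show ?thesis
        using 1 2 3 4 M_cond[OF less.prems, of k]
      proof eventually_elim
        case (elim x)
        have "(\<Sum>j\<in>?I. real_cond_exp P (F k) (D j) x) = (\<Sum>j\<in>?I. if j \<le> k then D j x else 0)"
          using elim(4) by (intro sum.cong) auto
        also have "\<dots> = (\<Sum>j\<in>{1..inf n k}. D j x)"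
          by (simp only: sum.If_cases finite_Diff finite_multi_box I) simp
        finally show ?case
          using elim by simp
      qed
    qed
    then show ?case
      using D_meas D_int by blast
  qed
  then show ?thesis
    by (simp add: ortho_diffs_def)
qed

end

section \<open>Truncation and uniform integrability\<close>

lemma card_multi_box: "card {1..n :: 'd::finite \<Rightarrow> nat} = (\<Prod>q\<in>UNIV. n q)"
proof -
  have "{1..n} = (\<Pi>\<^sub>E q\<in>UNIV. {1..n q})"
    by (auto simp: le_fun_def PiE_UNIV_domain Pi_iff)
  then have "card {1..n} = card (\<Pi>\<^sub>E q\<in>UNIV. {1..n q})"
    by (rule arg_cong)
  also have "\<dots> = (\<Prod>q\<in>UNIV. n q)"
    by (simp add: card_PiE)
  finally show ?thesis .
qed

text \<open>The larger of \<open>u\<close> and \<open>v\<close> controls \<open>s\<close> up to a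
  factor 2. If it is \<open>u\<close>, the constraint bounds \<open>s^2 / N\<close> by its own
  square over \<open>a\<close>, which trades a second power for a fourth.\<close>

lemma truncated_square_add_le:
  fixes u v s N a :: real
  assumes s: "s = u + v" and N: "N > 0" and a: "a > 0" and gt: "s\<^sup>2 / N > a"
  shows "s\<^sup>2 / N \<le> 4 * v\<^sup>2 / N + 16 * (u\<^sup>2)\<^sup>2 / (a * N\<^sup>2)"
proof (cases "\<bar>u\<bar> \<le> \<bar>v\<bar>")
  case True
  then have "\<bar>s\<bar> \<le> 2 * \<bar>v\<bar>"
    using s by linarith
  then have "s\<^sup>2 \<le> 4 * v\<^sup>2"
    using power_mono[of "\<bar>s\<bar>" "2 * \<bar>v\<bar>" 2] by (simp add: power_mult_distrib)
  then have "s\<^sup>2 / N \<le> 4 * v\<^sup>2 / N"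
    using N by (intro divide_right_mono) auto
  moreover have "0 \<le> 16 * (u\<^sup>2)\<^sup>2 / (a * N\<^sup>2)"
    using a by simp
  ultimately show ?thesis
    by linarith
next
  case False
  then have "\<bar>s\<bar> \<le> 2 * \<bar>u\<bar>"
    using s by linarith
  then have "s\<^sup>2 \<le> 4 * u\<^sup>2"
    using power_mono[of "\<bar>s\<bar>" "2 * \<bar>u\<bar>" 2] by (simp add: power_mult_distrib)
  then have le: "s\<^sup>2 / N \<le> 4 * u\<^sup>2 / N"
    using N by (intro divide_right_mono) auto
  have "a * (s\<^sup>2 / N) \<le> (s\<^sup>2 / N) * (s\<^sup>2 / N)"
    using gt a by (intro mult_right_mono) auto
  also have "\<dots> \<le> (4 * u\<^sup>2 / N) * (4 * u\<^sup>2 / N)"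
    using le N by (intro mult_mono) auto
  finally have "s\<^sup>2 / N \<le> (4 * u\<^sup>2 / N) * (4 * u\<^sup>2 / N) / a"
    by (simp only: pos_le_divide_eq[OF a] mult.commute[of a])
  also have "\<dots> = 16 * (u\<^sup>2)\<^sup>2 / (a * N\<^sup>2)"
    by (simp add: power2_eq_square mult_ac)
  finally show ?thesis
    using N by (smt (verit) divide_nonneg_pos zero_le_power2)
qed

context commuting_prob_space
begin

text \<open>The tail bound \<open>\<epsilon>\<close> is common to all indices, which makes the
  estimate uniform in \<open>n\<close>. The factor \<open>16 ^ CARD('d)\<close> combines
  \<open>4 ^ CARD('d)\<close> from the projection with the same from the maximal inequality.\<close>

lemma ortho_diffs_truncated_max_le:
  assumes G: "ortho_diffs G" and n: "1 \<le> n" and A: "A > 0" and a: "a > 0"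
    and sq: "\<And>i. 1 \<le> i \<Longrightarrow> integrable P (\<lambda>x. (G i x)\<^sup>2)"
    and tail: "\<And>i. 1 \<le> i \<Longrightarrow> (\<integral>x. (G i x)\<^sup>2 * indicator {t. \<bar>t\<bar> > A} (G i x) \<partial>P) \<le> \<epsilon>"
    and Y: "\<And>x. x \<in> space P \<Longrightarrow> Y x = (MAX j\<in>{1..n}. \<bar>\<Sum>i\<in>{1..j}. G i x\<bar> / sqrt (real (\<Prod>q\<in>UNIV. n q)))"
  shows "(\<integral>\<^sup>+x. ennreal ((Y x)\<^sup>2 * indicator {y. (Y y)\<^sup>2 > a} x) \<partial>P)
    \<le> ennreal (4 * 16 ^ CARD('d) * \<epsilon> + 16 * 4 ^ CARD('d) * (4 ^ CARD('d) * (2 ^ CARD('d) * A)\<^sup>2)\<^sup>2 / a)"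
proof -
  define N where "N = real (\<Prod>q\<in>UNIV. n q)"
  have nq: "1 \<le> n q" for q
    using n by (simp add: le_fun_def)
  have N: "N > 0"
    unfolding N_def of_nat_0_less_iff by (rule prod_pos) (use nq in \<open>auto simp: Suc_le_eq\<close>)
  have n_box: "n \<in> {1..n}"
    using n by (meson atLeastAtMost_iff order_refl)
  have box1: "1 \<le> i" if "i \<in> {1..j}" for i j :: "'d \<Rightarrow> nat"
    using that by (meson atLeastAtMost_iff)
  note G_meas [measurable] = ortho_diffsD(3)[OF G]
  define T where "T i x = G i x * indicator {t. \<bar>t\<bar> \<le> A} (G i x)" for i x
  define T' where "T' i x = G i x * indicator {t. \<bar>t\<bar> > A} (G i x)" for i x
  have T_meas: "T i \<in> borel_measurable P" "T' i \<in> borel_measurable P" if "1 \<le> i" for i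
    unfolding T_def T'_def using G_meas[OF that] by measurable
  have T_le: "\<bar>T i x\<bar> \<le> A" for i x
    using A by (simp add: T_def indicator_def)
  have T_int: "integrable P (T i)" if "1 \<le> i" for i
    by (rule integrable_const_bound[of _ A]) (use T_le T_meas(1)[OF that] in auto)
  have T'_sq_eq: "(T' i x)\<^sup>2 = (G i x)\<^sup>2 * indicator {t. \<bar>t\<bar> > A} (G i x)" for i x
    by (simp add: T'_def indicator_def)
  have T'_sq: "integrable P (\<lambda>x. (T' i x)\<^sup>2)" if "1 \<le> i" for i
  proof (rule Bochner_Integration.integrable_bound[OF sq[OF that]])
    show "(\<lambda>x. (T' i x)\<^sup>2) \<in> borel_measurable P"
      using T_meas(2)[OF that] by measurable
  qed (simp add: T'_sq_eq indicator_def)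
  have T'_int: "integrable P (T' i)" if "1 \<le> i" for i
    by (rule integrable_of_square[OF T_meas(2)[OF that] T'_sq[OF that]])

  define H where "H i = diff_proj i (T i)" for i
  define H' where "H' i = diff_proj i (T' i)" for i
  have H: "ortho_diffs H" and H': "ortho_diffs H'"
    unfolding H_def H'_def using T_int T'_int by (auto intro: ortho_diffs_diff_proj)
  have split: "AE x in P. G i x = H i x + H' i x" if i: "1 \<le> i" for i
  proof -
    have eq: "(\<lambda>x. T i x + T' i x) = G i"
      by (auto simp: T_def T'_def indicator_def)
    show ?thesis
      using diff_proj_add[OF T_int[OF i] T'_int[OF i], of i] diff_proj_ortho_diffs[OF G i]
      unfolding eq H_def H'_def by eventually_elim simp
  qed
  have H_bound: "AE x in P. \<bar>H i x\<bar> \<le> 2 ^ CARD('d) * A" if "i \<in> {1..n}" for i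
    unfolding H_def by (rule diff_proj_bound[OF T_int[OF box1[OF that]]]) (simp add: T_le)
  have H'_sq: "integrable P (\<lambda>x. (H' i x)\<^sup>2)" if "1 \<le> i" for i
    unfolding H'_def by (rule diff_proj_second_moment(1)[OF T_meas(2)[OF that] T'_sq[OF that]])
  have H'_le: "(\<integral>x. (H' i x)\<^sup>2 \<partial>P) \<le> 4 ^ CARD('d) * \<epsilon>" if "1 \<le> i" for i
  proof -
    have "(\<integral>x. (H' i x)\<^sup>2 \<partial>P) \<le> 4 ^ CARD('d) * (\<integral>x. (T' i x)\<^sup>2 \<partial>P)"
      unfolding H'_def by (rule diff_proj_second_moment(2)[OF T_meas(2)[OF that] T'_sq[OF that]])
    also have "\<dots> \<le> 4 ^ CARD('d) * \<epsilon>"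
      using tail[OF that] by (simp add: T'_sq_eq)
    finally show ?thesis .
  qed

  define S where "S j x = (\<Sum>i\<in>{1..j}. H i x)" for j x
  define S' where "S' j x = (\<Sum>i\<in>{1..j}. H' i x)" for j x
  have S_meas: "S j \<in> borel_measurable P" "S' j \<in> borel_measurable P" for j
    unfolding S_def S'_def
    by (rule measurable_F_P[OF ortho_diffs_sum_measurable[OF _ order_refl]], fact)+
  have S_bdd: "ae_bounded P (S j)" if "j \<in> {1..n}" for j
    unfolding S_def
  proof (rule ae_bounded_sum)
    fix i assume i: "i \<in> {1..j}"
    then have "i \<in> {1..n}"
      using that by (meson atLeastAtMost_iff order_trans)
    then show "ae_bounded P (H i)"
      by (intro ae_boundedI[OF ortho_diffsD(3)[OF H box1[OF i]] H_bound])
  qed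
  have S_sq: "integrable P (\<lambda>x. ((S j x)\<^sup>2)\<^sup>2)" if "j \<in> {1..n}" for j
    by (intro integrable_ae_bounded ae_bounded_power S_bdd that)
  have S'_sq: "integrable P (\<lambda>x. (S' j x)\<^sup>2)" for j
    unfolding S'_def by (intro integrable_sum_square ortho_diffsD(3)[OF H'] H'_sq box1)

  \<comment> \<open>\<open>U\<close> already collects squares, so its second moment is a fourth
    moment of the bounded part; \<open>V\<close> collects absolute values.\<close>
  define U where "U x = (MAX j\<in>{1..n}. (S j x)\<^sup>2)" for x
  define V where "V x = (MAX j\<in>{1..n}. \<bar>S' j x\<bar>)" for x
  have ne: "{1..n} \<noteq> {}"
    using n_box by blast
  have U_int: "integrable P (\<lambda>x. (U x)\<^sup>2)"
    unfolding U_def using S_meas by (intro integrable_Max_square finite_multi_box ne S_sq) auto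
  have V_int: "integrable P (\<lambda>x. (V x)\<^sup>2)"
    unfolding V_def using S_meas S'_sq by (intro integrable_Max_square finite_multi_box ne) auto
  have "(\<integral>x. (U x)\<^sup>2 \<partial>P) \<le> 4 ^ CARD('d) * (\<integral>x. ((S n x)\<^sup>2)\<^sup>2 \<partial>P)"
    unfolding U_def S_def
    by (rule ortho_diffs_maximal[OF H n convex_power2]) (use S_sq in \<open>simp_all add: S_def\<close>)
  also have "(\<integral>x. ((S n x)\<^sup>2)\<^sup>2 \<partial>P) \<le> (4 ^ CARD('d) * (2 ^ CARD('d) * A)\<^sup>2 * N)\<^sup>2"
  proof -
    have "((S n x)\<^sup>2)\<^sup>2 = S n x ^ 4" for x
      by (simp flip: power_mult)
    moreover have "0 < 2 ^ CARD('d) * A"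
      using A by simp
    ultimately show ?thesis
      using ortho_diffs_fourth_moment[OF H _ H_bound n] by (simp only: S_def N_def)
  qed
  finally have U_le: "(\<integral>x. (U x)\<^sup>2 \<partial>P) \<le> 4 ^ CARD('d) * (4 ^ CARD('d) * (2 ^ CARD('d) * A)\<^sup>2 * N)\<^sup>2"
    by simp
  have "convex_on UNIV (\<lambda>t::real. \<bar>t\<bar>)"
    using convex_on_dist[of UNIV "0::real"] by (simp add: dist_real_def)
  then have "(\<integral>x. (V x)\<^sup>2 \<partial>P) \<le> 4 ^ CARD('d) * (\<integral>x. \<bar>S' n x\<bar>\<^sup>2 \<partial>P)"
    unfolding V_def S'_def
    by (rule ortho_diffs_maximal[OF H' n]) (use S'_sq in \<open>simp_all add: S'_def\<close>)
  also have "(\<integral>x. \<bar>S' n x\<bar>\<^sup>2 \<partial>P) = (\<Sum>i\<in>{1..n}. \<integral>x. (H' i x)\<^sup>2 \<partial>P)"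
    unfolding S'_def power2_abs by (rule ortho_diffs_second_moment[OF H' H'_sq[OF box1]])
  also have "\<dots> \<le> (\<Sum>i\<in>{1..n}. 4 ^ CARD('d) * \<epsilon>)"
    by (intro sum_mono H'_le box1)
  also have "\<dots> = 4 ^ CARD('d) * \<epsilon> * N"
    by (simp only: sum_constant card_multi_box N_def mult.commute)
  finally have V_le: "(\<integral>x. (V x)\<^sup>2 \<partial>P) \<le> 16 ^ CARD('d) * \<epsilon> * N"
    by (simp add: power_mult_distrib[symmetric] mult.assoc[symmetric])

  have "AE x in P. \<forall>i\<in>{1..n}. G i x = H i x + H' i x"
    by (intro AE_finite_allI finite_multi_box split box1)
  then have "AE x in P. (Y x)\<^sup>2 * indicator {y. (Y y)\<^sup>2 > a} x \<le> 4 * (V x)\<^sup>2 / N + 16 * (U x)\<^sup>2 / (a * N\<^sup>2)"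
    using AE_space
  proof eventually_elim
    case (elim x)
    show ?case
    proof (cases "(Y x)\<^sup>2 > a")
      case False
      then show ?thesis
        using N a by simp
    next
      case True
      \<comment> \<open>The sum is split at an index that attains the maximum; \<open>U\<close> and
        \<open>V\<close> dominate the two parts whichever index this is.\<close>
      have "Y x \<in> (\<lambda>j. \<bar>\<Sum>i\<in>{1..j}. G i x\<bar> / sqrt N) ` {1..n}"
        unfolding Y[OF elim(2)] N_def using ne by (intro Max_in) (auto simp: finite_multi_box)
      then obtain j where j: "j \<in> {1..n}" "Y x = \<bar>\<Sum>i\<in>{1..j}. G i x\<bar> / sqrt N"
        by blast
      have sub: "i \<in> {1..n}" if "i \<in> {1..j}" for i
        using that j(1) by (meson atLeastAtMost_iff order_trans)
      have sum: "(\<Sum>i\<in>{1..j}. G i x) = S j x + S' j x"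
        unfolding S_def S'_def sum.distrib[symmetric]
        by (intro sum.cong refl bspec[OF elim(1)] sub)
      have Y2: "(Y x)\<^sup>2 = (\<Sum>i\<in>{1..j}. G i x)\<^sup>2 / N"
        using N by (simp add: j(2) power_divide)
      have "(Y x)\<^sup>2 \<le> 4 * (S' j x)\<^sup>2 / N + 16 * ((S j x)\<^sup>2)\<^sup>2 / (a * N\<^sup>2)"
        unfolding Y2 by (rule truncated_square_add_le[OF sum N a]) (use True Y2 in simp)
      also have "\<dots> \<le> 4 * (V x)\<^sup>2 / N + 16 * (U x)\<^sup>2 / (a * N\<^sup>2)"
      proof (intro add_mono divide_right_mono mult_left_mono)
        have "\<bar>S' j x\<bar> \<le> V x" "(S j x)\<^sup>2 \<le> U x"
          unfolding V_def U_def using j(1) by (auto intro!: Max_ge finite_imageI finite_multi_box)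
        then show "(S' j x)\<^sup>2 \<le> (V x)\<^sup>2" "((S j x)\<^sup>2)\<^sup>2 \<le> (U x)\<^sup>2"
          using power_mono[of "\<bar>S' j x\<bar>" "V x" 2] power_mono[of "(S j x)\<^sup>2" "U x" 2] by simp_all
      qed (use N a in auto)
      finally show ?thesis
        using True by simp
    qed
  qed
  then have "(\<integral>\<^sup>+x. ennreal ((Y x)\<^sup>2 * indicator {y. (Y y)\<^sup>2 > a} x) \<partial>P)
      \<le> (\<integral>\<^sup>+x. ennreal (4 * (V x)\<^sup>2 / N + 16 * (U x)\<^sup>2 / (a * N\<^sup>2)) \<partial>P)"
    by (intro nn_integral_mono_AE) (auto elim!: eventually_mono intro: ennreal_leI)
  also have "\<dots> = ennreal (\<integral>x. 4 * (V x)\<^sup>2 / N + 16 * (U x)\<^sup>2 / (a * N\<^sup>2) \<partial>P)"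
    using U_int V_int N a by (intro nn_integral_eq_integral) auto
  also have "(\<integral>x. 4 * (V x)\<^sup>2 / N + 16 * (U x)\<^sup>2 / (a * N\<^sup>2) \<partial>P)
      = 4 / N * (\<integral>x. (V x)\<^sup>2 \<partial>P) + 16 / (a * N\<^sup>2) * (\<integral>x. (U x)\<^sup>2 \<partial>P)"
    using U_int V_int by simp
  also have "\<dots> \<le> 4 / N * (16 ^ CARD('d) * \<epsilon> * N)
      + 16 / (a * N\<^sup>2) * (4 ^ CARD('d) * (4 ^ CARD('d) * (2 ^ CARD('d) * A)\<^sup>2 * N)\<^sup>2)"
    using U_le V_le N a by (intro add_mono mult_left_mono) auto
  \<comment> \<open>The bound for \<open>V\<close> is linear and that for \<open>U\<close> quadratic
    in \<open>N\<close>, so the normalization cancels both.\<close>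
  also have "\<dots> = 4 * 16 ^ CARD('d) * \<epsilon> + 16 * 4 ^ CARD('d) * (4 ^ CARD('d) * (2 ^ CARD('d) * A)\<^sup>2)\<^sup>2 / a"
    using N a by (simp add: power_mult_distrib)
  finally show ?thesis
    by (simp add: ennreal_leI)
qed

end

section \<open>Stationary marginals, vanishing tails and the limit\<close>

lemma eventually_multi_at_top_ge: "eventually (\<lambda>n. c \<le> n) multi_at_top"
proof -
  have "eventually (\<lambda>n. c q \<le> n q) multi_at_top" for q
    using filterlim_ident[of multi_at_top] unfolding filterlim_multi_at_top
    by (auto simp: filterlim_at_top)
  then show ?thesis
    unfolding le_fun_def by (rule eventually_all_finite)
qed

text \<open>The finite-dimensional laws are compared on the single index \<open>1\<close>, shifted
  by \<open>i - 1\<close>; evaluation at that index yields the marginals.\<close>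

lemma strictly_stationary_distr:
  assumes D: "strictly_stationary P D" and i: "1 \<le> i"
  shows "distr P borel (D i) = distr P borel (D 1)"
proof -
  define k where "k = (\<lambda>q. i q - 1)"
  have ik: "1 + k = i"
    using i by (auto simp: fun_eq_iff k_def le_fun_def Suc_le_eq)
  have meas: "D j \<in> borel_measurable P" if "1 \<le> j" for j
    using D that by (simp add: strictly_stationary_def)
  have ev: "distr (distr P (Pi\<^sub>M {1} (\<lambda>_. borel)) (\<lambda>x. \<lambda>j\<in>{1}. D (f j) x)) borel (\<lambda>w. w 1) = distr P borel (D (f 1))"
    if "1 \<le> f 1" for f
  proof (subst distr_distr)
    show "(\<lambda>x. \<lambda>j\<in>{1}. D (f j) x) \<in> measurable P (Pi\<^sub>M {1} (\<lambda>_. borel))"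
      using that meas by (intro measurable_restrict) auto
    show "(\<lambda>w. w 1) \<in> measurable (Pi\<^sub>M {1} (\<lambda>_. borel)) borel"
      by (rule measurable_component_singleton) simp
    show "distr P borel ((\<lambda>w. w 1) \<circ> (\<lambda>x. \<lambda>j\<in>{1}. D (f j) x)) = distr P borel (D (f 1))"
      by (simp add: o_def)
  qed
  have "distr P (Pi\<^sub>M {1} (\<lambda>_. borel)) (\<lambda>x. \<lambda>j\<in>{1}. D (j + k) x) =
      distr P (Pi\<^sub>M {1} (\<lambda>_. borel)) (\<lambda>x. \<lambda>j\<in>{1}. D j x)"
    using D unfolding strictly_stationary_def by (elim conjE allE[of _ k] allE[of _ "{1}"]) simp
  then show ?thesis
    using ev[of "\<lambda>j. j + k"] ev[of "\<lambda>j. j"] i by (simp add: ik)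
qed

lemma tail_second_moment_tendsto_0:
  fixes f :: "'a \<Rightarrow> real"
  assumes [measurable]: "f \<in> borel_measurable M" and sq: "integrable M (\<lambda>x. (f x)\<^sup>2)"
  shows "((\<lambda>A. \<integral>x. (f x)\<^sup>2 * indicator {t. \<bar>t\<bar> > A} (f x) \<partial>M) \<longlongrightarrow> 0) at_top"
proof -
  have "((\<lambda>A. \<integral>x. (f x)\<^sup>2 * indicator {t. \<bar>t\<bar> > A} (f x) \<partial>M) \<longlongrightarrow> (\<integral>x. 0 \<partial>M)) at_top"
  proof (rule integral_dominated_convergence_at_top[OF _ _ sq])
    show "AE x in M. ((\<lambda>A. (f x)\<^sup>2 * indicator {t. \<bar>t\<bar> > A} (f x)) \<longlongrightarrow> 0) at_top"
    proof (rule AE_I2, rule tendsto_eventually)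
      fix x
      show "eventually (\<lambda>A. (f x)\<^sup>2 * indicator {t. \<bar>t\<bar> > A} (f x) = 0) at_top"
        using eventually_ge_at_top[of "\<bar>f x\<bar>"] by eventually_elim simp
    qed
  qed (auto simp: indicator_def)
  then show ?thesis by simp
qed

theorem lemma3p1:
  fixes P :: "'a measure"
    and F :: "('d::finite \<Rightarrow> nat) \<Rightarrow> 'a measure"
    and M D :: "('d \<Rightarrow> nat) \<Rightarrow> 'a \<Rightarrow> real"
  assumes "prob_space P"
    and "commuting_filtration P F"
    and "orthomartingale P F M"
    and "orthomartingale_differences P M D"
    and "strictly_stationary P D"
    and "integrable P (\<lambda>x. (D 1 x)\<^sup>2)"
  shows "((\<lambda>a::real. Limsup multi_at_top (\<lambda>n.
            \<integral>\<^sup>+x. ennreal ((normalized_max M n x)\<^sup>2 *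
                   indicator {y. (normalized_max M n y)\<^sup>2 > a} x) \<partial>P))
          \<longlongrightarrow> 0) at_top"
proof -
  interpret commuting_prob_space P F
    using assms(1,2) by (simp add: commuting_prob_space_def commuting_prob_space_axioms_def)
  note [measurable] = strictly_stationary_def[THEN iffD1, OF assms(5), THEN conjunct1, rule_format]
  have G: "ortho_diffs D"
    by (rule ortho_diffs_orthomartingale_differences[OF assms(3,4)])
  define \<epsilon> where "\<epsilon> A = (\<integral>x. (D 1 x)\<^sup>2 * indicator {t. \<bar>t\<bar> > A} (D 1 x) \<partial>P)" for A
  have sq: "integrable P (\<lambda>x. (D i x)\<^sup>2)" if i: "1 \<le> i" for i
  proof -
    have "integrable (distr P borel (D 1)) (\<lambda>t. t\<^sup>2)"
      using assms(6) by (simp add: integrable_distr_eq)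
    then have "integrable (distr P borel (D i)) (\<lambda>t. t\<^sup>2)"
      by (simp only: strictly_stationary_distr[OF assms(5) i])
    then show ?thesis
      using i by (simp add: integrable_distr_eq)
  qed
  have tail: "(\<integral>x. (D i x)\<^sup>2 * indicator {t. \<bar>t\<bar> > A} (D i x) \<partial>P) = \<epsilon> A" if i: "1 \<le> i" for i A
  proof -
    have "(\<integral>x. (D j x)\<^sup>2 * indicator {t. \<bar>t\<bar> > A} (D j x) \<partial>P) =
        (\<integral>t. t\<^sup>2 * indicator {t. \<bar>t\<bar> > A} t \<partial>distr P borel (D j))" if "1 \<le> j" for j
      using that by (intro integral_distr[symmetric]) auto
    then show ?thesis
      using i by (simp add: \<epsilon>_def strictly_stationary_distr[OF assms(5) i])
  qed
  define K :: real where "K = 4 * 16 ^ CARD('d)"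
  define C :: real where "C = 16 * 4 ^ CARD('d) * (4 ^ CARD('d) * (2 ^ CARD('d))\<^sup>2)\<^sup>2"
  \<comment> \<open>The level has to tend to infinity with \<open>A^4 / a\<close> still tending to
    0, so any positive exponent below 1/4 would serve. Three square roots give
    \<open>A^4 = sqrt a\<close>.\<close>
  define A where "A a = sqrt (sqrt (sqrt a))" for a :: real
  define h where "h a = K * \<epsilon> (A a) + C * inverse (sqrt a)" for a
  have bound: "Limsup multi_at_top (\<lambda>n. \<integral>\<^sup>+x. ennreal ((normalized_max M n x)\<^sup>2 *
        indicator {y. (normalized_max M n y)\<^sup>2 > a} x) \<partial>P) \<le> ennreal (h a)" if a: "a > 0" for a
  proof (rule Limsup_bounded)
    show "eventually (\<lambda>n. (\<integral>\<^sup>+x. ennreal ((normalized_max M n x)\<^sup>2 *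
        indicator {y. (normalized_max M n y)\<^sup>2 > a} x) \<partial>P) \<le> ennreal (h a)) multi_at_top"
      using eventually_multi_at_top_ge[of 1]
    proof eventually_elim
      case (elim n)
      have "A a > 0"
        using a by (simp add: A_def)
      have A4: "(A a ^ 4) = sqrt a"
      proof -
        have "A a ^ 4 = ((A a)\<^sup>2)\<^sup>2"
          by (simp flip: power_mult)
        then show ?thesis
          using a by (simp add: A_def)
      qed
      have Y: "normalized_max M n x = (MAX j\<in>{1..n}. \<bar>\<Sum>i\<in>{1..j}. D i x\<bar> / sqrt (real (\<Prod>q\<in>UNIV. n q)))"
        if "x \<in> space P" for x
      proof -
        have "M j x = (\<Sum>i\<in>{1..j}. D i x)" if "j \<in> {1..n}" for j
          using assms(4) \<open>x \<in> space P\<close> that unfolding orthomartingale_differences_def by (meson atLeastAtMost_iff)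
        then show ?thesis
          unfolding normalized_max_def by (intro arg_cong[where f = Max] image_cong refl) simp
      qed
      have "(\<integral>\<^sup>+x. ennreal ((normalized_max M n x)\<^sup>2 *
          indicator {y. (normalized_max M n y)\<^sup>2 > a} x) \<partial>P)
        \<le> ennreal (4 * 16 ^ CARD('d) * \<epsilon> (A a) + 16 * 4 ^ CARD('d) * (4 ^ CARD('d) * (2 ^ CARD('d) * A a)\<^sup>2)\<^sup>2 / a)"
        by (rule ortho_diffs_truncated_max_le[OF G elim \<open>A a > 0\<close> a sq]) (simp_all add: tail Y)
      also have "16 * 4 ^ CARD('d) * (4 ^ CARD('d) * (2 ^ CARD('d) * A a)\<^sup>2)\<^sup>2 / a = C * (A a ^ 4 / a)"
        by (simp add: C_def power_mult_distrib flip: power_mult)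
      also have "A a ^ 4 / a = inverse (sqrt a)"
        using a unfolding A4 by (simp add: field_simps)
      finally show ?case
        by (simp add: h_def K_def)
    qed
  qed
  have A_top: "filterlim A at_top at_top"
    unfolding A_def by (intro filterlim_compose[OF sqrt_at_top] filterlim_ident)
  have "(\<epsilon> \<longlongrightarrow> 0) at_top"
    unfolding \<epsilon>_def by (rule tail_second_moment_tendsto_0[OF _ assms(6)]) simp
  then have "((\<lambda>a. \<epsilon> (A a)) \<longlongrightarrow> 0) at_top"
    by (rule filterlim_compose[OF _ A_top])
  moreover have "((\<lambda>a::real. inverse (sqrt a)) \<longlongrightarrow> 0) at_top"
    by (rule filterlim_compose[OF tendsto_inverse_0_at_top[OF filterlim_ident] sqrt_at_top])
  ultimately have "(h \<longlongrightarrow> K * 0 + C * 0) at_top"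
    unfolding h_def by (intro tendsto_intros)
  then have h0: "((\<lambda>a. ennreal (h a)) \<longlongrightarrow> 0) at_top"
    using tendsto_ennrealI[of h 0] by simp
  show ?thesis
  proof (rule tendsto_sandwich[OF _ _ tendsto_const h0])
    show "eventually (\<lambda>a. Limsup multi_at_top (\<lambda>n. \<integral>\<^sup>+x. ennreal ((normalized_max M n x)\<^sup>2 *
        indicator {y. (normalized_max M n y)\<^sup>2 > a} x) \<partial>P) \<le> ennreal (h a)) at_top"
      using eventually_gt_at_top[of 0] by eventually_elim (rule bound)
  qed simp
qed

end
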